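(* Let $k\ge 1$ and let $\alpha_1,\dots,\alpha_k$ be positive integers, and let $\Delta_{\alpha_1,\dots,\alpha_k}(x_1,\dots,x_k)=\sum_{i=1}^k \alpha_i T(x_i)$ with $T(x)=\frac{x^2+x}{2}$. Then $\Delta_{\alpha_1,\dots,\alpha_k}$ is almost universal with one exception $8$ (i.e., it represents every nonnegative integer except exactly the integer $8$) if and only if it represents each of the integers $1,2,5,17,89$ and does not represent $8$. Moreover, there are exactly $80$ proper almost universal sums of triangular numbers with one exception $8$: exactly $7$ of them are quaternary ($k=4$) and exactly $73$ are quinary ($k=5$), and there are none with any other number of variables.
   Context: For an integer $x$, $T(x)=\frac{x^2+x}{2}$ is a triangular number. A sum $\Delta_{\alpha_1,\dots,\alpha_k}$ represents a nonnegative integer $n$ if $\Delta_{\alpha_1,\dots,\alpha_k}(x_1,\dots,x_k)=n$ has a solution $(x_1,\dots,x_k)\in\mathbb{Z}^k$. It is almost universal with one exception if it represents all nonnegative integers except a single one. An almost universal sum with one exception is called proper if for every proper subset $\{i_1,\dots,i_u\}\subsetneq\{1,\dots,k\}$, the partial sum $\Delta_{\alpha_{i_1},\dots,\alpha_{i_u}}$ fails to represent at least two nonnegative integers. Sums are counted up to reordering of the coefficients (i.e., with $\alpha_1\le\cdots\le\alpha_k$). *)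

theory Defs
  imports Main
begin

definition tri :: "int \<Rightarrow> int" where
  "tri x = (x\<^sup>2 + x) div 2"

(* A sum of triangular numbers is given by the list of its coefficients; its partial sums
   are the restrictions to a set of positions. The division in tri is exact, and the
   variables range over all integers. *)

definition partial_tri_sum :: "nat list \<Rightarrow> nat set \<Rightarrow> (nat \<Rightarrow> int) \<Rightarrow> int" where
  "partial_tri_sum \<alpha> I x = (\<Sum>i\<in>I. int (\<alpha> ! i) * tri (x i))"

definition partial_represents :: "nat list \<Rightarrow> nat set \<Rightarrow> nat \<Rightarrow> bool" where
  "partial_represents \<alpha> I n \<longleftrightarrow> (\<exists>x. partial_tri_sum \<alpha> I x = int n)"

definition represents :: "nat list \<Rightarrow> nat \<Rightarrow> bool" where
  "represents \<alpha> n \<longleftrightarrow> partial_represents \<alpha> {..<length \<alpha>} n"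

definition almost_universal_except :: "nat list \<Rightarrow> nat \<Rightarrow> bool" where
  "almost_universal_except \<alpha> m \<longleftrightarrow> (\<forall>n. represents \<alpha> n \<longleftrightarrow> n \<noteq> m)"

definition proper :: "nat list \<Rightarrow> bool" where
  "proper \<alpha> \<longleftrightarrow> (\<forall>I. I \<subset> {..<length \<alpha>} \<longrightarrow>
     (\<exists>m n. m \<noteq> n \<and> \<not> partial_represents \<alpha> I m \<and> \<not> partial_represents \<alpha> I n))"

definition tri_coeffs :: "nat list \<Rightarrow> bool" where
  "tri_coeffs \<alpha> \<longleftrightarrow> \<alpha> \<noteq> [] \<and> (\<forall>a\<in>set \<alpha>. 0 < a)"

(* Sums that differ only in the order of their coefficients are identified by taking the
   nondecreasing list as representative. *)

definition proper_almost_universal_sums :: "nat \<Rightarrow> nat list set" where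
  "proper_almost_universal_sums m =
     {\<alpha>. tri_coeffs \<alpha> \<and> sorted \<alpha> \<and> almost_universal_except \<alpha> m \<and> proper \<alpha>}"

end

theory Submission
  imports Defs "HOL-Number_Theory.Number_Theory" "HOL-Analysis.Summation_Tests"
    "HOL-Computational_Algebra.Squarefree"
begin

text \<open>
  A sum that represents 1, 2 and 5 but not 8 must contain the coefficients 1, 1, 3, all its other
  coefficients are at least 9, and the values 17 and 89 force a fourth coefficient between 10 and 17
  and, if that is 12, a fifth one. Everything then rests on the ternary sum with coefficients 1, 1, 3:
  it represents \<open>n\<close> unless \<open>8 * n + 5\<close> has the form \<open>9 ^ k * (9 * l + 6)\<close>, and the further coefficients
  are used to leave this exceptional set.

  For the ternary result, a squarefree \<open>m \<equiv> 5\<close> modulo 8 of the right shape is represented by a positive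
  ternary form of determinant 3 that does not take the value 6; by Hermite reduction this form takes the
  same values as \<open>x\<^sup>2 + y\<^sup>2 + 3 * z\<^sup>2\<close>. Constructing the form requires an integer \<open>P\<close> with prescribed
  Legendre symbols modulo the primes of \<open>m\<close> such that \<open>- 3 * m\<close> (or \<open>- m / 3\<close>) is a square modulo \<open>P\<close>.
  Instead of a prime \<open>P\<close> from Dirichlet's theorem, one uses any \<open>P\<close> that is a product of primes on which
  the quadratic character \<open>\<chi>\<close> of the discriminant equals 1. If all of these had the wrong symbols, then
  the sums over \<open>n\<close> of \<open>\<psi> n * (\<Sum>d | d dvd n. \<chi> d) / sqrt n\<close>, with \<open>\<psi>\<close> ranging over products of Legendre
  symbols, would cancel in a signed combination; but
  they stay bounded unless \<open>\<psi>\<close> is trivial or \<open>\<chi>\<close>, and diverge in these two cases.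
\<close>

section \<open>Legendre symbols\<close>

text \<open>The constants come from the prime 3. Reduction leaves two value sets for determinant 3,
  those of x^2 + y^2 + 3 z^2 and of x^2 + 2 (y^2 + y z + z^2). A congruence at 3 excludes the value
  6 = 2^2 + 2 of the second form, so it decides which of the two occurs. The sum with coefficients
  1, 1, 3 misses every n = 8 modulo 9. A fourth coefficient from 10 to 17 moves this class to a
  harmless one, except that 12 moves it to the class of 5, where n is missed exactly if (n - 5) / 9
  is. For 12 the remaining failures form the chain 8, 89, 818, ... under n -> 9 n + 17, that is, 8 n
  + 17 = 9^k. The fifth coefficient only has to step off this chain, and 81 = 89 - 8 fails to do so.
  A composite \<open>P\<close> suffices because the form uses it only through its Legendre symbols
  and a square root modulo \<open>P\<close>. Its prescribed symbols must multiply to 1, since a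
  nonzero divisor sum of the character at n forces the character to be 1 at n; the residue of
  \<open>m\<close> modulo 4 or 3 provides this.\<close>

lemma Legendre_cong:
  assumes "[a = b] (mod p)"
  shows "Legendre a p = Legendre b p"
proof -
  have "[a = 0] (mod p) \<longleftrightarrow> [b = 0] (mod p)" "QuadRes p a \<longleftrightarrow> QuadRes p b"
    using assms unfolding QuadRes_def by (meson cong_sym cong_trans)+
  then show ?thesis by (simp add: Legendre_def)
qed

lemma Legendre_range: "Legendre a p \<in> {-1, 0, 1}"
  by (simp add: Legendre_def)

lemma Legendre_eq_0_iff: "Legendre a p = 0 \<longleftrightarrow> p dvd a"
  by (simp add: Legendre_def cong_0_iff)

lemma Legendre_neq_0_cases: "\<not> p dvd a \<Longrightarrow> Legendre a p = 1 \<or> Legendre a p = -1"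
  by (auto simp add: Legendre_def cong_0_iff)

lemma Legendre_eq_1D: "Legendre a p = 1 \<Longrightarrow> \<exists>y. p dvd y\<^sup>2 - a"
  by (auto simp: Legendre_def QuadRes_def cong_iff_dvd_diff split: if_splits)

lemma Legendre_1: "1 < p \<Longrightarrow> Legendre 1 p = 1"
  by (auto simp: Legendre_def QuadRes_def cong_0_iff intro: exI[of _ 1])

text \<open>Two such values differ by at most 2. Used to turn Euler's criterion into an equality,
  and with modulus 4 to determine a product of signs.\<close>

lemma sign_cong_imp_eq:
  fixes x y p :: int
  assumes "[x = y] (mod p)" "2 < p" "x \<in> {-1, 0, 1}" "y \<in> {-1, 0, 1}"
  shows "x = y"
proof -
  have "p dvd x - y" using assms(1) by (simp add: cong_iff_dvd_diff)
  moreover have "\<bar>x - y\<bar> < p" using assms by auto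
  ultimately show ?thesis using dvd_imp_le_int[of "x - y" p] assms(2) by force
qed

lemma Legendre_mult:
  fixes p :: nat
  assumes "prime p" "2 < p"
  shows "Legendre (a * b) p = Legendre a p * Legendre b p"
proof (rule sign_cong_imp_eq[where p = "int p"])
  have "[Legendre (a * b) p = a ^ ((p - 1) div 2) * b ^ ((p - 1) div 2)] (mod p)"
    using euler_criterion[OF assms, of "a * b"] by (simp add: power_mult_distrib)
  moreover have "[Legendre a p * Legendre b p = a ^ ((p - 1) div 2) * b ^ ((p - 1) div 2)] (mod p)"
    by (intro cong_mult euler_criterion assms)
  ultimately show "[Legendre (a * b) p = Legendre a p * Legendre b p] (mod p)"
    by (meson cong_sym cong_trans)
  show "Legendre a p * Legendre b p \<in> {-1, 0, 1}"
    using Legendre_range[of a p] Legendre_range[of b p] by auto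
qed (use assms Legendre_range in auto)

lemma Legendre_minus_1:
  fixes p :: nat
  assumes "prime p" "2 < p"
  shows "Legendre (-1) p = (-1) ^ ((p - 1) div 2)"
proof (rule sign_cong_imp_eq[where p = "int p"])
  show "[Legendre (-1) p = (-1) ^ ((p - 1) div 2)] (mod p)"
    by (intro euler_criterion assms)
  show "(-1) ^ ((p - 1) div 2) \<in> {-1, 0, 1::int}"
    by (simp add: minus_one_power_iff)
qed (use assms Legendre_range in auto)

text \<open>If all units were squares, squaring would map \<open>{1..<p}\<close> onto itself and
  thus be injective there, but 1 and \<open>p - 1\<close> have the same square.\<close>

lemma ex_nonresidue:
  fixes p :: nat
  assumes "prime p" "2 < p"
  shows "\<exists>u. Legendre (int u) p = -1"
proof (rule ccontr)
  assume "\<nexists>u. Legendre (int u) p = -1"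
  then have all: "\<exists>y. int p dvd y\<^sup>2 - int u" if "\<not> p dvd u" for u
    using Legendre_neq_0_cases[of "int p" "int u"] Legendre_eq_1D that by (metis int_dvd_int_iff)
  define f where "f = (\<lambda>x. x\<^sup>2 mod p)"
  have "{1..<p} \<subseteq> f ` {1..<p}"
  proof
    fix u assume u: "u \<in> {1..<p}"
    then have "\<not> p dvd u" by (auto dest: dvd_imp_le)
    then obtain y where y: "int p dvd y\<^sup>2 - int u" using all by blast
    define x where "x = nat (y mod int p)"
    have x: "int x = y mod int p" using assms unfolding x_def by simp
    have "[int (x\<^sup>2) = int u] (mod int p)"
      using y unfolding cong_iff_dvd_diff[symmetric] by (simp add: x cong_def power_mod)
    then have c: "[x\<^sup>2 = u] (mod p)" using cong_int_iff by blast
    then have "f x = u" using u by (simp add: f_def cong_def)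
    moreover have "x \<noteq> 0" using \<open>f x = u\<close> u by (cases "x = 0") (auto simp: f_def)
    moreover have "x < p" using x pos_mod_bound[of "int p" y] assms by linarith
    ultimately show "u \<in> f ` {1..<p}" by force
  qed
  then have "inj_on f {1..<p}"
    by (metis card_image_le eq_card_imp_inj_on finite_atLeastLessThan card_mono finite_imageI le_antisym)
  moreover have "f 1 = f (p - 1)"
  proof -
    have "int (p - 1) = int p - 1" using assms by (simp add: of_nat_diff)
    then have "int ((p - 1)\<^sup>2) = 1 + int p * (int p - 2)"
      unfolding of_nat_power by (simp add: power2_eq_square algebra_simps)
    then have "[int ((p - 1)\<^sup>2) = int (1\<^sup>2)] (mod int p)" by (simp add: cong_iff_dvd_diff)
    then show ?thesis unfolding f_def cong_int_iff by (simp add: cong_def)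
  qed
  ultimately have "1 = p - 1" using assms by (auto simp: inj_on_def)
  then show False using assms by simp
qed

section \<open>Sums over divisors\<close>

text \<open>Summation by parts. The bound involves only the weight at the left end, so it is uniform
  in \<open>b\<close> and serves for tails as well.\<close>

lemma weighted_sum_bound:
  fixes f w :: "nat \<Rightarrow> real"
  assumes F: "\<And>k. \<bar>\<Sum>i<k. f i\<bar> \<le> C"
    and w: "\<And>i. a \<le> i \<Longrightarrow> 0 \<le> w i" "\<And>i. a \<le> i \<Longrightarrow> w (Suc i) \<le> w i"
  shows "\<bar>\<Sum>i=a..<b. w i * f i\<bar> \<le> 2 * C * w a"
proof (cases "a \<le> b")
  case True
  define F where "F = (\<lambda>k. \<Sum>i<k. f i)"
  have C: "0 \<le> C" using F[of 0] by simp
  have "(\<Sum>i=a..<b. w i * f i) = w b * F b - w a * F a + (\<Sum>i=a..<b. (w i - w (Suc i)) * F (Suc i))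
    \<and> (\<Sum>i=a..<b. w i - w (Suc i)) = w a - w b" using True
  proof (induction rule: dec_induct)
    case (step n)
    then show ?case by (simp add: F_def algebra_simps)
  qed simp
  then have eq: "(\<Sum>i=a..<b. w i * f i) = w b * F b - w a * F a + (\<Sum>i=a..<b. (w i - w (Suc i)) * F (Suc i))"
    and tel: "(\<Sum>i=a..<b. w i - w (Suc i)) = w a - w b" by blast+
  have "\<bar>\<Sum>i=a..<b. (w i - w (Suc i)) * F (Suc i)\<bar> \<le> (\<Sum>i=a..<b. (w i - w (Suc i)) * C)"
  proof (rule order_trans[OF sum_abs sum_mono])
    fix i assume "i \<in> {a..<b}"
    then show "\<bar>(w i - w (Suc i)) * F (Suc i)\<bar> \<le> (w i - w (Suc i)) * C"
      using w(2)[of i] F[of "Suc i"] by (auto simp: abs_mult F_def intro!: mult_left_mono)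
  qed
  also have "\<dots> = (w a - w b) * C" by (simp add: tel flip: sum_distrib_right)
  finally have "\<bar>\<Sum>i=a..<b. (w i - w (Suc i)) * F (Suc i)\<bar> \<le> (w a - w b) * C" .
  moreover have "\<bar>w b * F b\<bar> \<le> w b * C" "\<bar>w a * F a\<bar> \<le> w a * C"
    using w(1)[of a] w(1)[of b] True F[of a] F[of b] by (auto simp: abs_mult F_def intro!: mult_left_mono)
  ultimately show ?thesis unfolding eq by (simp add: algebra_simps)
next
  case False
  moreover have "0 \<le> C" using F[of 0] by simp
  ultimately show ?thesis using w(1)[of a] by simp
qed

text \<open>Each term is at most \<open>2 * (sqrt (n + 1) - sqrt n)\<close>, and these differences
  telescope.\<close>

lemma sum_inverse_sqrt_le: "(\<Sum>i=1..n. 1 / sqrt (real i)) \<le> 2 * sqrt (real n)"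
proof (induction n)
  case (Suc n)
  have "1 / sqrt (real (Suc n)) \<le> 2 * (sqrt (real (Suc n)) - sqrt (real n))"
  proof -
    have "1 = (sqrt (real (Suc n)) - sqrt (real n)) * (sqrt (real (Suc n)) + sqrt (real n))"
      by (simp add: algebra_simps)
    also have "\<dots> \<le> (sqrt (real (Suc n)) - sqrt (real n)) * (2 * sqrt (real (Suc n)))"
      by (intro mult_left_mono) auto
    finally show ?thesis by (simp add: field_simps)
  qed
  then show ?case using Suc by simp
qed simp

lemma divisor_sum_reindex:
  fixes h :: "nat \<Rightarrow> nat \<Rightarrow> 'a :: comm_monoid_add"
  shows "(\<Sum>n=1..x. \<Sum>d | d dvd n. h d (n div d)) =
    (\<Sum>(a, b) | 1 \<le> a \<and> 1 \<le> b \<and> a * b \<le> x. h a b)"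
proof -
  have "(\<Sum>n=1..x. \<Sum>d | d dvd n. h d (n div d)) =
      (\<Sum>(n, d)\<in>Sigma {1..x} (\<lambda>n. {d. d dvd n}). h d (n div d))"
    by (intro sum.Sigma) auto
  also have "\<dots> = (\<Sum>(a, b) | 1 \<le> a \<and> 1 \<le> b \<and> a * b \<le> x. h a b)"
    by (rule sum.reindex_bij_witness[of _ "\<lambda>(a, b). (a * b, a)" "\<lambda>(n, d). (d, n div d)"])
       (auto elim!: dvdE simp: Suc_le_eq)
  finally show ?thesis .
qed

text \<open>The hyperbola method at the abscissa 1/2; working there instead of at 1 is what makes the
  nonvanishing of \<open>L\<close>-functions unnecessary.\<close>

lemma divisor_sum_bounded:
  fixes f g :: "nat \<Rightarrow> real"
  assumes F: "\<And>k. \<bar>\<Sum>i<k. f i\<bar> \<le> C" and G: "\<And>k. \<bar>\<Sum>i<k. g i\<bar> \<le> C"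
    and f1: "\<And>n. \<bar>f n\<bar> \<le> 1" and g1: "\<And>n. \<bar>g n\<bar> \<le> 1"
  shows "\<bar>\<Sum>n=1..K\<^sup>2. (\<Sum>d | d dvd n. f d * g (n div d)) / sqrt (real n)\<bar> \<le> 4 * C\<^sup>2 + 8 * C"
proof -
  define f' where "f' = (\<lambda>n. 1 / sqrt (real n) * f n)"
  define g' where "g' = (\<lambda>n. 1 / sqrt (real n) * g n)"
  have C: "0 \<le> C" using F[of 0] by simp
  have dec: "1 / sqrt (real (Suc i)) \<le> 1 / sqrt (real i)" if "1 \<le> i" for i
    using that by (intro divide_left_mono) auto
  have full: "\<bar>\<Sum>i=1..K. 1 / sqrt (real i) * u i\<bar> \<le> 2 * C"
    and tail: "\<bar>\<Sum>i=Suc K..M. 1 / sqrt (real i) * u i\<bar> \<le> 2 * C / sqrt (real (Suc K))"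
    if u: "\<And>k. \<bar>\<Sum>i<k. u i\<bar> \<le> C" for u M
    using weighted_sum_bound[where w = "\<lambda>i. 1 / sqrt (real i)" and f = u and C = C and a = 1 and b = "Suc K"]
      weighted_sum_bound[where w = "\<lambda>i. 1 / sqrt (real i)" and f = u and C = C and a = "Suc K" and b = "Suc M"]
      u dec by (simp_all add: atLeastLessThanSuc_atLeastAtMost)
  \<comment> \<open>One arm of the hyperbola: the growth \<open>2 * sqrt K\<close> of the outer sum
    is absorbed by the factor \<open>1 / sqrt (K + 1)\<close> that the inner tail provides.\<close>
  have mixed: "\<bar>\<Sum>a=1..K. 1 / sqrt (real a) * v a * (\<Sum>b=Suc K..M a. 1 / sqrt (real b) * u b)\<bar> \<le> 4 * C"
    if u: "\<And>k. \<bar>\<Sum>i<k. u i\<bar> \<le> C" and v: "\<And>n. \<bar>v n\<bar> \<le> 1" for u v :: "nat \<Rightarrow> real" and M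
  proof -
    have "\<bar>\<Sum>a=1..K. 1 / sqrt (real a) * v a * (\<Sum>b=Suc K..M a. 1 / sqrt (real b) * u b)\<bar>
      \<le> (\<Sum>a=1..K. 1 / sqrt (real a) * (2 * C / sqrt (real (Suc K))))"
    proof (rule order_trans[OF sum_abs sum_mono])
      fix a assume "a \<in> {1..K}"
      have "\<bar>1 / sqrt (real a) * v a\<bar> \<le> 1 / sqrt (real a)"
        using v[of a] by (simp add: divide_right_mono)
      then show "\<bar>1 / sqrt (real a) * v a * (\<Sum>b=Suc K..M a. 1 / sqrt (real b) * u b)\<bar>
          \<le> 1 / sqrt (real a) * (2 * C / sqrt (real (Suc K)))"
        using tail[OF u, of "M a"] unfolding abs_mult[of "_ * _" "sum _ _"]
        by (intro mult_mono) auto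
    qed
    also have "\<dots> \<le> 2 * sqrt (real K) * (2 * C / sqrt (real (Suc K)))"
      unfolding sum_distrib_right[symmetric] using C
      by (intro mult_right_mono sum_inverse_sqrt_le) auto
    also have "\<dots> = 4 * C * (sqrt (real K) / sqrt (real (Suc K)))" by simp
    also have "\<dots> \<le> 4 * C * 1" using C by (intro mult_left_mono) auto
    finally show ?thesis by simp
  qed
  \<comment> \<open>A point with \<open>a * b \<le> K\<^sup>2\<close> has a coordinate of at most
    \<open>K\<close>, so the region is a square \<open>R1\<close> together with two arms that are
    mirror images of each other.\<close>
  define R where "R = {(a, b). 1 \<le> a \<and> 1 \<le> b \<and> a * b \<le> K\<^sup>2}"
  define R1 where "R1 = {1..K} \<times> {1..K}"
  define R2 where "R2 = Sigma {1..K} (\<lambda>a. {Suc K..K\<^sup>2 div a})"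
  define R3 where "R3 = (\<lambda>(b, a). (a, b)) ` R2"
  have swap: "inj_on (\<lambda>(b, a). (a, b)) R2" by (auto simp: inj_on_def)
  have fin: "finite R1" "finite R2" "finite R3" by (auto simp: R1_def R2_def R3_def)
  have "R = R1 \<union> R2 \<union> R3"
  proof (intro equalityI subsetI)
    fix z assume "z \<in> R"
    then obtain a b where z: "z = (a, b)" "1 \<le> a" "1 \<le> b" "a * b \<le> K\<^sup>2" by (auto simp: R_def)
    have "a \<le> K \<or> b \<le> K"
    proof (rule ccontr)
      assume "\<not> (a \<le> K \<or> b \<le> K)"
      then have "K * K < a * b" by (intro mult_strict_mono) auto
      then show False using z by (simp add: power2_eq_square)
    qed
    moreover have "b \<le> K\<^sup>2 div a" "a \<le> K\<^sup>2 div b"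
      using z by (auto simp: less_eq_div_iff_mult_less_eq mult.commute)
    ultimately show "z \<in> R1 \<union> R2 \<union> R3" using z by (fastforce simp: R1_def R2_def R3_def)
  next
    fix z assume "z \<in> R1 \<union> R2 \<union> R3"
    then show "z \<in> R"
    proof (elim UnE)
      assume "z \<in> R1"
      then show ?thesis by (auto simp: R1_def R_def power2_eq_square intro: mult_mono)
    qed (auto simp: R2_def R3_def R_def less_eq_div_iff_mult_less_eq mult.commute)
  qed
  moreover have "R1 \<inter> R2 = {}" "(R1 \<union> R2) \<inter> R3 = {}"
    by (auto simp: R1_def R2_def R3_def)
  ultimately have split: "sum h R = sum h R1 + sum h R2 + sum h R3" for h :: "nat \<times> nat \<Rightarrow> real"
    using fin by (simp add: sum.union_disjoint)
  have "(\<Sum>n=1..K\<^sup>2. (\<Sum>d | d dvd n. f d * g (n div d)) / sqrt (real n)) =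
      (\<Sum>n=1..K\<^sup>2. \<Sum>d | d dvd n. f' d * g' (n div d))"
  proof (intro sum.cong refl)
    fix n assume "n \<in> {1..K\<^sup>2}"
    show "(\<Sum>d | d dvd n. f d * g (n div d)) / sqrt (real n) = (\<Sum>d | d dvd n. f' d * g' (n div d))"
      unfolding sum_divide_distrib
      by (intro sum.cong refl) (auto simp: f'_def g'_def real_sqrt_mult elim!: dvdE)
  qed
  also have "\<dots> = (\<Sum>(a, b)\<in>R. f' a * g' b)"
    unfolding R_def by (rule divisor_sum_reindex)
  also have "\<dots> = (\<Sum>a=1..K. f' a) * (\<Sum>b=1..K. g' b)
      + (\<Sum>a=1..K. f' a * (\<Sum>b=Suc K..K\<^sup>2 div a. g' b))
      + (\<Sum>b=1..K. g' b * (\<Sum>a=Suc K..K\<^sup>2 div b. f' a))"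
  proof -
    have "(\<Sum>(a, b)\<in>R1. f' a * g' b) = (\<Sum>a=1..K. f' a) * (\<Sum>b=1..K. g' b)"
      unfolding R1_def by (simp add: sum_product sum.cartesian_product)
    moreover have R2: "(\<Sum>(a, b)\<in>R2. u a * v b) = (\<Sum>a=1..K. u a * (\<Sum>b=Suc K..K\<^sup>2 div a. v b))"
      for u v :: "nat \<Rightarrow> real"
      unfolding R2_def sum_distrib_left by (simp add: sum.Sigma)
    moreover have "(\<Sum>(a, b)\<in>R3. f' a * g' b) = (\<Sum>(b, a)\<in>R2. g' b * f' a)"
      unfolding R3_def sum.reindex[OF swap] by (intro sum.cong) auto
    ultimately show ?thesis unfolding split by simp
  qed
  also have "\<bar>\<dots>\<bar> \<le> (2 * C) * (2 * C) + 4 * C + 4 * C"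
  proof -
    have "\<bar>(\<Sum>a=1..K. f' a) * (\<Sum>b=1..K. g' b)\<bar> \<le> (2 * C) * (2 * C)"
      unfolding abs_mult f'_def g'_def using C by (intro mult_mono full F G) auto
    moreover have "\<bar>\<Sum>a=1..K. f' a * (\<Sum>b=Suc K..K\<^sup>2 div a. g' b)\<bar> \<le> 4 * C"
      "\<bar>\<Sum>b=1..K. g' b * (\<Sum>a=Suc K..K\<^sup>2 div b. f' a)\<bar> \<le> 4 * C"
      unfolding f'_def g'_def by (intro mixed F G f1 g1)+
    ultimately show ?thesis by linarith
  qed
  finally show ?thesis by (simp add: power2_eq_square)
qed

section \<open>Quadratic characters\<close>

text \<open>All subsets \<open>S\<close> share the modulus \<open>\<Prod>Q\<close>:
  \<open>S = {}\<close> gives the principal character, and the characters of \<open>S\<close> and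
  \<open>Q - S\<close> multiply to that of \<open>Q\<close>.\<close>

definition quad_char :: "nat set \<Rightarrow> nat set \<Rightarrow> nat \<Rightarrow> real" where
  "quad_char Q S n =
     (if coprime n (\<Prod>Q) then \<Prod>p\<in>S. real_of_int (Legendre (int n) (int p)) else 0)"

locale odd_primes =
  fixes Q :: "nat set"
  assumes finite_Q: "finite Q" and prime_Q: "\<And>p. p \<in> Q \<Longrightarrow> prime p" and odd_Q: "\<And>p. p \<in> Q \<Longrightarrow> 2 < p"
begin

lemma prod_Q_pos: "0 < \<Prod>Q"
  using prime_Q prime_gt_0_nat by (auto intro!: prod_pos)

lemma coprime_prod_Q_iff: "coprime n (\<Prod>Q) \<longleftrightarrow> (\<forall>p\<in>Q. \<not> p dvd n)"
proof
  assume *: "coprime n (\<Prod>Q)"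
  show "\<forall>p\<in>Q. \<not> p dvd n"
  proof (intro ballI notI)
    fix p assume "p \<in> Q" "p dvd n"
    moreover then have "p dvd \<Prod>Q" using dvd_prodI[of Q p "\<lambda>x. x"] finite_Q by simp
    ultimately show False using * prime_Q[of p] coprime_common_divisor_nat not_prime_1 by metis
  qed
qed (auto intro!: prod_coprime_right prime_imp_coprime_nat[OF prime_Q, THEN coprime_commute[THEN iffD1]])

lemma quad_char_mult:
  assumes "S \<subseteq> Q"
  shows "quad_char Q S (a * b) = quad_char Q S a * quad_char Q S b"
proof -
  have "(\<Prod>p\<in>S. real_of_int (Legendre (int (a * b)) (int p))) =
      (\<Prod>p\<in>S. real_of_int (Legendre (int a) (int p)) * real_of_int (Legendre (int b) (int p)))"
    using assms prime_Q odd_Q by (intro prod.cong) (auto simp: Legendre_mult subset_iff)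
  then show ?thesis by (auto simp: quad_char_def prod.distrib)
qed

lemma quad_char_1: "S \<subseteq> Q \<Longrightarrow> quad_char Q S 1 = 1"
  using Legendre_1 odd_Q by (force simp: quad_char_def intro!: prod.neutral)

lemma quad_char_coprime:
  assumes "S \<subseteq> Q" "coprime n (\<Prod>Q)"
  shows "quad_char Q S n = 1 \<or> quad_char Q S n = -1"
proof -
  have "finite S" using assms(1) finite_Q finite_subset by auto
  then have "(\<Prod>p\<in>S. real_of_int (Legendre (int n) (int p))) \<in> {1, -1}" using assms(1)
  proof (induction S)
    case (insert p S)
    have "\<not> int p dvd int n" using assms(2) insert.prems by (simp add: coprime_prod_Q_iff)
    then show ?case using Legendre_neq_0_cases[of "int p" "int n"] insert by auto
  qed auto
  then show ?thesis using assms(2) by (simp add: quad_char_def)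
qed

lemma quad_char_range: "S \<subseteq> Q \<Longrightarrow> quad_char Q S n \<in> {-1, 0, 1}"
  using quad_char_coprime[of S n] by (cases "coprime n (\<Prod>Q)") (auto simp: quad_char_def)

lemma quad_char_cong:
  assumes "S \<subseteq> Q" "[m = n] (mod \<Prod>Q)"
  shows "quad_char Q S m = quad_char Q S n"
proof -
  have "coprime m (\<Prod>Q) \<longleftrightarrow> coprime n (\<Prod>Q)"
    using assms(2) by (metis cong_imp_coprime cong_sym)
  moreover have "Legendre (int m) (int p) = Legendre (int n) (int p)" if "p \<in> S" for p
  proof (rule Legendre_cong)
    have "p dvd \<Prod>Q" using that assms(1) finite_Q dvd_prodI[of Q p "\<lambda>x. x"] by auto
    then show "[int m = int n] (mod int p)" using assms(2) by (simp add: cong_int_iff cong_dvd_modulus_nat)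
  qed
  ultimately show ?thesis by (simp add: quad_char_def)
qed

text \<open>By the Chinese remainder theorem, take a nonresidue modulo one prime of \<open>S\<close>
  and 1 modulo all other primes of \<open>Q\<close>.\<close>

lemma ex_quad_char_minus_1:
  assumes "S \<subseteq> Q" "S \<noteq> {}"
  shows "\<exists>a. quad_char Q S a = -1"
proof -
  obtain p where p: "p \<in> S" using assms by blast
  then have pQ: "p \<in> Q" using assms by blast
  obtain u where u: "Legendre (int u) (int p) = -1"
    using ex_nonresidue[OF prime_Q odd_Q, OF pQ pQ] by blast
  have "coprime p (\<Prod>(Q - {p}))"
    using prime_Q pQ by (intro prod_coprime_right) (auto intro: primes_coprime)
  then obtain a where a: "[a = u] (mod p)" "[a = 1] (mod \<Prod>(Q - {p}))"
    using binary_chinese_remainder_nat by blast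
  have La: "Legendre (int a) (int p) = -1" using u Legendre_cong[of "int a" "int u"] a(1) by (simp add: cong_int_iff)
  have L1: "Legendre (int a) (int q) = 1" if "q \<in> Q - {p}" for q
  proof -
    have "q dvd \<Prod>(Q - {p})" using that finite_Q dvd_prodI[of "Q - {p}" q "\<lambda>x. x"] by auto
    then have "[int a = int 1] (mod int q)" using a(2) cong_dvd_modulus_nat cong_int_iff by blast
    then have "Legendre (int a) (int q) = Legendre 1 (int q)" using Legendre_cong by force
    then show ?thesis using odd_Q[of q] that by (simp add: Legendre_1)
  qed
  have "coprime a (\<Prod>Q)" unfolding coprime_prod_Q_iff
  proof
    fix q assume "q \<in> Q"
    then have "Legendre (int a) (int q) \<noteq> 0" using La L1[of q] by (cases "q = p") auto
    then show "\<not> q dvd a" by (simp add: Legendre_eq_0_iff)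
  qed
  moreover have "(\<Prod>q\<in>S. real_of_int (Legendre (int a) (int q))) = -1"
  proof -
    have "finite S" using assms finite_Q finite_subset by auto
    then have "(\<Prod>q\<in>S. real_of_int (Legendre (int a) (int q))) =
        real_of_int (Legendre (int a) (int p)) * (\<Prod>q\<in>S-{p}. real_of_int (Legendre (int a) (int q)))"
      using p by (simp add: prod.remove)
    also have "(\<Prod>q\<in>S-{p}. real_of_int (Legendre (int a) (int q))) = 1"
      using L1 assms(1) by (intro prod.neutral) auto
    finally show ?thesis using La by simp
  qed
  ultimately show ?thesis by (auto simp: quad_char_def)
qed

text \<open>Multiplication by an \<open>a\<close> with character value -1 permutes the residues and
  negates the sum.\<close>

lemma quad_char_sum_period:
  assumes "S \<subseteq> Q" "S \<noteq> {}"
  shows "(\<Sum>n<\<Prod>Q. quad_char Q S n) = 0"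
proof -
  obtain a where a: "quad_char Q S a = -1" using ex_quad_char_minus_1[OF assms] by blast
  then have cop: "coprime a (\<Prod>Q)" by (auto simp: quad_char_def split: if_splits)
  let ?f = "\<lambda>n. a * n mod \<Prod>Q"
  have "inj_on ?f {..<\<Prod>Q}"
  proof (rule inj_onI)
    fix x y assume xy: "x \<in> {..<\<Prod>Q}" "y \<in> {..<\<Prod>Q}" "?f x = ?f y"
    then have "[a * x = a * y] (mod \<Prod>Q)" by (simp add: cong_def)
    then have "[x = y] (mod \<Prod>Q)" using cop by (simp add: cong_mult_lcancel_nat)
    then show "x = y" using xy by (simp add: cong_def)
  qed
  moreover have "?f ` {..<\<Prod>Q} \<subseteq> {..<\<Prod>Q}" using prod_Q_pos by auto
  ultimately have "bij_betw ?f {..<\<Prod>Q} {..<\<Prod>Q}"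
    by (simp add: bij_betw_def endo_inj_surj)
  then have "(\<Sum>n<\<Prod>Q. quad_char Q S n) = (\<Sum>n<\<Prod>Q. quad_char Q S (?f n))"
    by (rule sum.reindex_bij_betw[symmetric])
  also have "\<dots> = (\<Sum>n<\<Prod>Q. - quad_char Q S n)"
    using a quad_char_mult[OF assms(1), of a] quad_char_cong[OF assms(1), of "a * n mod \<Prod>Q" "a * n" for n]
    by (intro sum.cong) (auto simp: cong_def)
  finally show ?thesis by (simp add: sum_negf)
qed

text \<open>Full periods cancel, and what remains has fewer than \<open>\<Prod>Q\<close>
  terms.\<close>

lemma quad_char_sum_bounded:
  assumes "S \<subseteq> Q" "S \<noteq> {}"
  shows "\<bar>\<Sum>n<k. quad_char Q S n\<bar> \<le> real (\<Prod>Q)"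
proof (induction k rule: less_induct)
  case (less k)
  define N where "N = \<Prod>Q"
  show ?case
  proof (cases "k < N")
    case True
    have "\<bar>\<Sum>n<k. quad_char Q S n\<bar> \<le> (\<Sum>n<k. 1)"
    proof (rule order_trans[OF sum_abs sum_mono])
      show "\<bar>quad_char Q S n\<bar> \<le> 1" for n using quad_char_range[OF assms(1), of n] by auto
    qed
    then show ?thesis using True unfolding N_def[symmetric] by simp
  next
    case False
    have "(\<Sum>n<k. quad_char Q S n) = (\<Sum>n<N. quad_char Q S n) + (\<Sum>n=N..<k. quad_char Q S n)"
      using False sum.atLeastLessThan_concat[of 0 N k "quad_char Q S"] by (simp add: lessThan_atLeast0)
    also have "(\<Sum>n=N..<k. quad_char Q S n) = (\<Sum>n<k-N. quad_char Q S (n + N))"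
      using sum.shift_bounds_nat_ivl[of "quad_char Q S" 0 N "k - N"] False by (simp add: lessThan_atLeast0)
    also have "\<dots> = (\<Sum>n<k-N. quad_char Q S n)"
      by (intro sum.cong quad_char_cong[OF assms(1)]) (auto simp: cong_def N_def)
    finally have "(\<Sum>n<k. quad_char Q S n) = (\<Sum>n<k-N. quad_char Q S n)"
      using quad_char_sum_period[OF assms] by (simp add: N_def)
    moreover have "k - N < k" using prod_Q_pos False by (simp add: N_def)
    ultimately show ?thesis using less by presburger
  qed
qed

end

section \<open>Divisor sums of real characters as Euler products\<close>

definition char_divisor_sum :: "(nat \<Rightarrow> real) \<Rightarrow> nat \<Rightarrow> real" where
  "char_divisor_sum f n = (\<Sum>d | d dvd n. f d)"

lemma prime_decompose:
  assumes "1 < (n::nat)"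
  obtains q a u where "prime q" "n = q ^ a * u" "\<not> q dvd u" "0 < u" "u < n"
proof -
  obtain q where q: "prime q" "q dvd n" using assms prime_factor_nat[of n] by auto
  define a where "a = multiplicity q n"
  have "n \<noteq> 0" "\<not> is_unit q" using assms q(1) by auto
  then obtain u where u: "n = q ^ a * u" "\<not> q dvd u"
    using multiplicity_decompose'[of n q] unfolding a_def by blast
  have "0 < a" using q assms by (simp add: a_def prime_multiplicity_gt_zero_iff)
  then have "1 < q ^ a" using q(1) prime_gt_1_nat one_less_power by blast
  moreover have u0: "0 < u" using u(2) by (cases "u = 0") auto
  ultimately have "1 * u < q ^ a * u" by (rule mult_strict_right_mono)
  then have "u < n" using u(1) by simp
  then show ?thesis using that[of q a u] q(1) u u0 by blast
qed

locale real_char =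
  fixes f :: "nat \<Rightarrow> real"
  assumes f_1: "f 1 = 1" and f_mult: "\<And>a b. f (a * b) = f a * f b" and f_range: "\<And>n. f n \<in> {-1, 0, 1}"
begin

text \<open>A divisor not divisible by \<open>q\<close> divides \<open>u\<close>; the others are
  \<open>q\<close> times a divisor of \<open>q ^ a * u\<close>.\<close>

lemma char_divisor_sum_Suc:
  assumes q: "prime q" "\<not> q dvd u" and u: "0 < u"
  shows "char_divisor_sum f (q ^ Suc a * u) = char_divisor_sum f u + f q * char_divisor_sum f (q ^ a * u)"
proof -
  have q0: "q > 0" using q prime_gt_0_nat by blast
  have "{d. d dvd q ^ Suc a * u} = {d. d dvd u} \<union> (*) q ` {d. d dvd q ^ a * u}" (is "?L = ?R")
  proof (intro equalityI subsetI)
    fix d assume d: "d \<in> ?L"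
    show "d \<in> ?R"
    proof (cases "q dvd d")
      case True
      then obtain e where e: "d = q * e" by blast
      then have "e dvd q ^ a * u" using d q0 by (simp add: mult.assoc)
      then show ?thesis using e by blast
    next
      case False
      then have "coprime d (q ^ Suc a)" using q(1) by (metis coprime_commute coprime_power_right_iff prime_imp_coprime)
      then show ?thesis using d coprime_dvd_mult_right_iff by blast
    qed
  qed (auto simp: mult.assoc)
  moreover have "{d. d dvd u} \<inter> (*) q ` {d. d dvd q ^ a * u} = {}"
    using q by (auto dest: dvd_mult_left)
  moreover have "finite {d. d dvd u}" "finite {d. d dvd q ^ a * u}" using u q0 by auto
  ultimately have "char_divisor_sum f (q ^ Suc a * u)
      = sum f {d. d dvd u} + sum f ((*) q ` {d. d dvd q ^ a * u})"
    unfolding char_divisor_sum_def by (simp add: sum.union_disjoint)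
  also have "sum f ((*) q ` {d. d dvd q ^ a * u}) = f q * sum f {d. d dvd q ^ a * u}"
    using q0 by (subst sum.reindex) (auto simp: inj_on_def f_mult sum_distrib_left)
  finally show ?thesis by (simp add: char_divisor_sum_def)
qed

lemma char_divisor_sum_prime_power:
  assumes "prime q" "\<not> q dvd u" "0 < u"
  shows "char_divisor_sum f (q ^ a * u) = (\<Sum>j\<le>a. f q ^ j) * char_divisor_sum f u"
proof (induction a)
  case (Suc a)
  have "(\<Sum>j\<le>Suc a. f q ^ j) = 1 + f q * (\<Sum>j\<le>a. f q ^ j)"
    by (subst sum.atMost_Suc_shift) (simp add: sum_distrib_left)
  then show ?case unfolding char_divisor_sum_Suc[OF assms] Suc by (simp add: algebra_simps)
qed simp

text \<open>This is the Euler factor at \<open>q\<close>. It is never negative, it is at least 1 for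
  even \<open>a\<close>, and it vanishes only if \<open>f q = -1\<close> and \<open>a\<close> is
  odd. The lemmas on nonnegativity, squares and odd multiplicities rest on these three
  facts.\<close>

lemma geometric_sum_cases:
  "(\<Sum>j\<le>a. f q ^ j) = (if f q = 1 then real (Suc a) else if f q = 0 then 1 else if even a then 1 else 0)"
proof (induction a)
  case (Suc a)
  then show ?case using f_range[of q] by auto
qed simp

lemma char_divisor_sum_1: "char_divisor_sum f 1 = 1"
  using f_1 by (simp add: char_divisor_sum_def)

lemma char_divisor_sum_nonneg: "0 < n \<Longrightarrow> 0 \<le> char_divisor_sum f n"
proof (induction n rule: less_induct)
  case (less n)
  show ?case
  proof (cases "n = 1")
    case True
    then show ?thesis using char_divisor_sum_1 by simp
  next
    case False
    then obtain q a u where "prime q" "n = q ^ a * u" "\<not> q dvd u" "0 < u" "u < n"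
      using prime_decompose[of n] less.prems by (metis less_one nat_neq_iff)
    then show ?thesis using less.IH[of u] by (simp add: char_divisor_sum_prime_power geometric_sum_cases)
  qed
qed

text \<open>The source of divergence: in a sum weighted by \<open>1 / sqrt n\<close>, the term of a
  square \<open>n\<^sup>2\<close> is at least \<open>1 / n\<close>.\<close>

lemma char_divisor_sum_square: "0 < n \<Longrightarrow> 1 \<le> char_divisor_sum f (n\<^sup>2)"
proof (induction n rule: less_induct)
  case (less n)
  show ?case
  proof (cases "n = 1")
    case True
    then show ?thesis using char_divisor_sum_1 by simp
  next
    case False
    then obtain q a u where *: "prime q" "n = q ^ a * u" "\<not> q dvd u" "0 < u" "u < n"
      using prime_decompose[of n] less.prems by (metis less_one nat_neq_iff)
    have "char_divisor_sum f (n\<^sup>2) = (\<Sum>j\<le>a*2. f q ^ j) * char_divisor_sum f (u\<^sup>2)"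
      using * by (subst char_divisor_sum_prime_power[symmetric])
        (auto simp: power_mult power_mult_distrib dest: prime_dvd_power)
    moreover have "1 * 1 \<le> (\<Sum>j\<le>a*2. f q ^ j) * char_divisor_sum f (u\<^sup>2)"
      using less.IH[of u] * by (intro mult_mono) (auto simp: geometric_sum_cases)
    ultimately show ?thesis by simp
  qed
qed

text \<open>Hence the squarefree part of an \<open>n\<close> with nonzero divisor sum contains no
  prime at which the character is -1.\<close>

lemma char_divisor_sum_odd_multiplicity:
  assumes "0 < n" "prime q" "odd (multiplicity q n)" "char_divisor_sum f n \<noteq> 0"
  shows "f q \<noteq> -1"
proof
  assume "f q = -1"
  define a where "a = multiplicity q n"
  have "n \<noteq> 0" "\<not> is_unit q" using assms by auto
  then obtain u where u: "n = q ^ a * u" "\<not> q dvd u"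
    using multiplicity_decompose'[of n q] unfolding a_def by blast
  then have "0 < u" by (metis dvd_0_right gr0I)
  then have "char_divisor_sum f n = (\<Sum>j\<le>a. f q ^ j) * char_divisor_sum f u"
    using char_divisor_sum_prime_power[OF assms(2) u(2)] unfolding u(1) by blast
  then show False using assms(3,4) \<open>f q = -1\<close> geometric_sum_cases[where q = q and a = a] by (simp add: a_def)
qed

end

text \<open>Since \<open>j * N + 1 \<le> N * (j + 1)\<close>, the harmonic series is dominated by
  \<open>N\<close> times this sum.\<close>

lemma harmonic_progression_unbounded:
  assumes "0 < N"
  shows "\<exists>J. B < (\<Sum>j<J. 1 / real (j * N + 1))"
proof (rule ccontr)
  assume "\<not> ?thesis"
  then have *: "(\<Sum>j<J. 1 / real (j * N + 1)) \<le> B" for J by (meson linorder_not_less)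
  have "summable (\<lambda>n. inverse (real (Suc n)))"
  proof (rule summableI_nonneg_bounded)
    fix J
    have "(\<Sum>n<J. inverse (real (Suc n))) \<le> (\<Sum>n<J. real N * (1 / real (n * N + 1)))"
    proof (rule sum_mono)
      fix n
      have "n * N + 1 \<le> N * Suc n" using assms by simp
      then have "real (n * N + 1) \<le> real N * real (Suc n)" by (metis of_nat_le_iff of_nat_mult)
      moreover have "inverse y \<le> real N * (1 / x)" if "x \<le> real N * y" "0 < x" "0 < y" for x y :: real
        using that by (simp add: field_simps)
      ultimately show "inverse (real (Suc n)) \<le> real N * (1 / real (n * N + 1))"
        by (metis of_nat_0_less_iff zero_less_Suc Suc_eq_plus1)
    qed
    also have "\<dots> \<le> real N * B" unfolding sum_distrib_left[symmetric] using * by (intro mult_left_mono) auto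
    finally show "(\<Sum>n<J. inverse (real (Suc n))) \<le> real N * B" .
  qed simp
  then show False using not_summable_harmonic[where 'a = real] summable_Suc_iff by blast
qed

context odd_primes
begin

lemma real_char_quad_char: "S \<subseteq> Q \<Longrightarrow> real_char (quad_char Q S)"
  by unfold_locales (use quad_char_1 quad_char_mult quad_char_range in auto)

lemma quad_char_split:
  assumes "S \<subseteq> Q"
  shows "quad_char Q Q n = quad_char Q (Q - S) n * quad_char Q S n"
  using assms finite_Q by (simp add: quad_char_def prod.subset_diff)

text \<open>For \<open>n = d * e\<close> the characters satisfy S(e) = S(n) S(d), because S(d) is a
  sign. Twisting the divisor sum by a genus character thus splits it into a convolution of two
  complementary characters, to which the hyperbola bound applies.\<close>

lemma divisor_sum_quad_char:
  assumes "S \<subseteq> Q" "coprime n (\<Prod>Q)" "0 < n"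
  shows "(\<Sum>d | d dvd n. quad_char Q (Q - S) d * quad_char Q S (n div d)) =
    quad_char Q S n * char_divisor_sum (quad_char Q Q) n"
  unfolding char_divisor_sum_def sum_distrib_left
proof (intro sum.cong refl)
  fix d assume "d \<in> {d. d dvd n}"
  then obtain e where e: "n = d * e" by auto
  have "coprime d (\<Prod>Q)" using assms e by simp
  then have "quad_char Q S d * quad_char Q S d = 1" using quad_char_coprime[OF assms(1)] by fastforce
  moreover have "n div d = e" using e assms(3) by auto
  ultimately show "quad_char Q (Q - S) d * quad_char Q S (n div d) = quad_char Q S n * quad_char Q Q d"
    using e assms(1) unfolding quad_char_split[OF assms(1), of d]
    by (simp add: quad_char_mult algebra_simps)
qed

lemma divisor_sum_quad_char_not_coprime:
  assumes "\<not> coprime n (\<Prod>Q)"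
  shows "(\<Sum>d | d dvd n. quad_char Q R d * quad_char Q S (n div d)) = 0"
proof (intro sum.neutral ballI)
  fix d assume "d \<in> {d. d dvd n}"
  then have "n = d * (n div d)" by simp
  then have "\<not> (coprime d (\<Prod>Q) \<and> coprime (n div d) (\<Prod>Q))" using assms by (metis coprime_mult_left_iff)
  then show "quad_char Q R d * quad_char Q S (n div d) = 0" by (auto simp: quad_char_def)
qed

text \<open>Exchanging \<open>d\<close> and \<open>n div d\<close> gives this symmetry. A nonzero
  divisor sum therefore forces the character of \<open>n\<close> to be 1, which is the reason for
  the condition that the prescribed signs multiply to 1.\<close>

lemma quad_char_all_divisor_sum:
  assumes "coprime n (\<Prod>Q)" "0 < n"
  shows "quad_char Q Q n * char_divisor_sum (quad_char Q Q) n = char_divisor_sum (quad_char Q Q) n"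
proof -
  have "quad_char Q Q n * char_divisor_sum (quad_char Q Q) n =
      (\<Sum>d | d dvd n. quad_char Q {} d * quad_char Q Q (n div d))"
    using divisor_sum_quad_char[of Q n] assms by simp
  also have "\<dots> = (\<Sum>d | d dvd n. quad_char Q Q (n div d))"
  proof (intro sum.cong refl)
    fix d assume "d \<in> {d. d dvd n}"
    then have "coprime d (\<Prod>Q)" using assms coprime_divisors dvd_refl by blast
    then show "quad_char Q {} d * quad_char Q Q (n div d) = quad_char Q Q (n div d)"
      by (simp add: quad_char_def)
  qed
  also have "\<dots> = (\<Sum>d | d dvd n. quad_char Q Q d)"
    using assms(2) by (intro sum.reindex_bij_witness[of _ "\<lambda>d. n div d" "\<lambda>d. n div d"]) (auto elim!: dvdE)
  finally show ?thesis by (simp add: char_divisor_sum_def)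
qed

text \<open>If no \<open>n\<close> were admissible, the nonnegative weights \<open>\<Prod>p\<in>Q. (1 + \<epsilon> p * (n/p))\<close> times the divisor
  sum would vanish for every \<open>n\<close>. Expanding the product over the subsets \<open>S\<close> of \<open>Q\<close>, the terms with
  \<open>S = {}\<close> and \<open>S = Q\<close> grow like a harmonic sum, and all others stay bounded.\<close>

lemma ex_prescribed_Legendre:
  assumes \<epsilon>: "\<And>p. p \<in> Q \<Longrightarrow> \<epsilon> p = 1 \<or> \<epsilon> p = (-1::int)" and prod_\<epsilon>: "(\<Prod>p\<in>Q. \<epsilon> p) = 1" and "Q \<noteq> {}"
  shows "\<exists>n>0. coprime n (\<Prod>Q) \<and> (\<forall>p\<in>Q. Legendre (int n) (int p) = \<epsilon> p)
    \<and> char_divisor_sum (quad_char Q Q) n \<noteq> 0"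
proof (rule ccontr)
  assume neg: "\<not> ?thesis"
  define N where "N = \<Prod>Q"
  define r where "r = char_divisor_sum (quad_char Q Q)"
  define e where "e = (\<lambda>S. \<Prod>p\<in>S. real_of_int (\<epsilon> p))"
  define D where "D = (\<lambda>S n. \<Sum>d | d dvd n. quad_char Q (Q - S) d * quad_char Q S (n div d))"
  define T where "T = (\<lambda>S K. \<Sum>n=1..K\<^sup>2. D S n / sqrt (real n))"
  \<comment> \<open>The bound of \<open>divisor_sum_bounded\<close> with \<open>C = N\<close>:
    partial sums of a nonprincipal character modulo \<open>N\<close> are at most \<open>N\<close> in
    absolute value.\<close>
  define B where "B = 4 * (real N)\<^sup>2 + 8 * real N"
  interpret real_char "quad_char Q Q" by (rule real_char_quad_char) simp
  have e_abs: "\<bar>e S\<bar> = 1" if "S \<subseteq> Q" for S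
  proof -
    have "\<bar>real_of_int (\<epsilon> p)\<bar> = 1" if "p \<in> Q" for p using \<epsilon>[OF that] by auto
    then show ?thesis using that unfolding e_def abs_prod by (intro prod.neutral) auto
  qed
  have e_Q: "e Q = 1" using prod_\<epsilon> unfolding e_def by (simp flip: of_int_prod)
  have zero: "(\<Sum>S\<in>Pow Q. e S * D S n) = 0" if "0 < n" for n
  proof (cases "coprime n N")
    case True
    then have cop: "coprime n (\<Prod>Q)" by (simp add: N_def)
    have "(\<Sum>S\<in>Pow Q. e S * D S n) = (\<Sum>S\<in>Pow Q. e S * quad_char Q S n) * r n"
      unfolding sum_distrib_right D_def r_def using cop that by (intro sum.cong) (auto simp: divisor_sum_quad_char)
    also have "(\<Sum>S\<in>Pow Q. e S * quad_char Q S n) =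
        (\<Sum>S\<in>Pow Q. (\<Prod>p\<in>S. real_of_int (\<epsilon> p * Legendre (int n) (int p))) * (\<Prod>p\<in>Q - S. 1))"
      using cop by (intro sum.cong) (auto simp: e_def quad_char_def prod.distrib)
    also have "\<dots> = (\<Prod>p\<in>Q. real_of_int (\<epsilon> p * Legendre (int n) (int p)) + 1)"
      using prod_add[OF finite_Q, of "\<lambda>p. real_of_int (\<epsilon> p * Legendre (int n) (int p))" "\<lambda>_. 1"] by simp
    finally have eq: "(\<Sum>S\<in>Pow Q. e S * D S n) =
        (\<Prod>p\<in>Q. real_of_int (\<epsilon> p * Legendre (int n) (int p)) + 1) * r n" .
    show ?thesis
    proof (cases "r n = 0")
      case False
      then obtain p where p: "p \<in> Q" "Legendre (int n) (int p) \<noteq> \<epsilon> p"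
        using neg \<open>0 < n\<close> cop by (auto simp: r_def)
      have "\<not> int p dvd int n" using cop p by (simp add: coprime_prod_Q_iff)
      then have "\<epsilon> p * Legendre (int n) (int p) = -1"
        using p Legendre_neq_0_cases[of "int p" "int n"] \<epsilon>[of p] by auto
      then have "real_of_int (\<epsilon> p * Legendre (int n) (int p)) + 1 = 0" by simp
      then have "(\<Prod>p\<in>Q. real_of_int (\<epsilon> p * Legendre (int n) (int p)) + 1) = 0"
        using p(1) finite_Q prod_zero by fast
      then show ?thesis unfolding eq by simp
    qed (simp add: eq)
  qed (simp add: D_def N_def divisor_sum_quad_char_not_coprime)
  have T_zero: "(\<Sum>S\<in>Pow Q. e S * T S K) = 0" for K
  proof -
    have "(\<Sum>S\<in>Pow Q. e S * T S K) = (\<Sum>n=1..K\<^sup>2. \<Sum>S\<in>Pow Q. e S * D S n / sqrt (real n))"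
      unfolding T_def sum_distrib_left by (subst sum.swap) simp
    also have "\<dots> = (\<Sum>n=1..K\<^sup>2. (\<Sum>S\<in>Pow Q. e S * D S n) / sqrt (real n))"
      by (simp add: sum_divide_distrib)
    also have "\<dots> = 0" using zero by simp
    finally show ?thesis .
  qed
  have T_bounded: "\<bar>T S K\<bar> \<le> B" if "S \<subseteq> Q" "S \<noteq> {}" "S \<noteq> Q" for S K
    unfolding T_def D_def B_def N_def
  proof (rule divisor_sum_bounded)
    show "\<bar>\<Sum>i<k. quad_char Q (Q - S) i\<bar> \<le> real (\<Prod>Q)" for k
      using that by (intro quad_char_sum_bounded) auto
    show "\<bar>\<Sum>i<k. quad_char Q S i\<bar> \<le> real (\<Prod>Q)" for k
      using that by (intro quad_char_sum_bounded) auto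
    show "\<bar>quad_char Q (Q - S) n\<bar> \<le> 1" for n using quad_char_range[of "Q - S" n] by auto
    show "\<bar>quad_char Q S n\<bar> \<le> 1" for n using quad_char_range[of S n] that by auto
  qed
  have D_empty: "D {} n = (if coprime n N then r n else 0)" 
    and D_Q: "D Q n = (if coprime n N then r n else 0)" if "0 < n" for n
  proof -
    have "quad_char Q {} n = 1" if "coprime n (\<Prod>Q)" using that by (simp add: quad_char_def)
    then show "D {} n = (if coprime n N then r n else 0)"
      using divisor_sum_quad_char[of "{}" n] divisor_sum_quad_char_not_coprime[of n "Q - {}" "{}"] that
      by (auto simp: D_def N_def r_def)
    show "D Q n = (if coprime n N then r n else 0)"
      using divisor_sum_quad_char[of Q n] divisor_sum_quad_char_not_coprime[of n "Q - Q" Q]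
        quad_char_all_divisor_sum[of n] that
      by (auto simp: D_def N_def r_def)
  qed
  have r_nonneg: "0 \<le> r n" if "0 < n" for n using char_divisor_sum_nonneg[OF that] by (simp add: r_def)
  have T_Q: "0 \<le> T Q K" for K
    unfolding T_def by (intro sum_nonneg) (auto simp: D_Q r_nonneg)
  \<comment> \<open>Keep only the squares of the numbers \<open>j * N + 1\<close>, which are coprime
    to \<open>N\<close>; all other terms are nonnegative.\<close>
  have T_empty: "(\<Sum>j<J. 1 / real (j * N + 1)) \<le> T {} (J * N)" if "0 < N" for J
  proof -
    let ?g = "\<lambda>j. (j * N + 1)\<^sup>2"
    have inj: "inj_on ?g {..<J}" using that by (auto simp: inj_on_def power2_eq_iff_nonneg)
    have "(\<Sum>j<J. 1 / real (j * N + 1)) \<le> (\<Sum>j<J. D {} (?g j) / sqrt (real (?g j)))"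
    proof (rule sum_mono)
      fix j
      have "coprime (j * N + 1) N" by (metis coprime_1_left coprime_commute gcd_add_mult coprime_iff_gcd_eq_1 add.commute)
      then have "coprime (?g j) N" by simp
      moreover have "1 \<le> r (?g j)" unfolding r_def by (rule char_divisor_sum_square) simp
      ultimately have "1 \<le> D {} (?g j)" by (subst D_empty) auto
      moreover have "sqrt (real (?g j)) = real (j * N + 1)"
        by (metis of_nat_0_le_iff of_nat_power real_sqrt_unique)
      ultimately show "1 / real (j * N + 1) \<le> D {} (?g j) / sqrt (real (?g j))"
        by (simp add: divide_right_mono del: of_nat_add of_nat_Suc of_nat_mult)
    qed
    also have "\<dots> = (\<Sum>n\<in>?g ` {..<J}. D {} n / sqrt (real n))"
      using inj by (simp add: sum.reindex del: of_nat_power)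
    also have "\<dots> \<le> T {} (J * N)" unfolding T_def
    proof (rule sum_mono2)
      show "?g ` {..<J} \<subseteq> {1..(J * N)\<^sup>2}"
      proof
        fix n assume "n \<in> ?g ` {..<J}"
        then obtain j where j: "j < J" "n = ?g j" by auto
        have "j * N + 1 \<le> j * N + N" using that by simp
        also have "\<dots> = Suc j * N" by simp
        also have "\<dots> \<le> J * N" using j by (intro mult_right_mono) auto
        finally show "n \<in> {1..(J * N)\<^sup>2}" using j by (simp add: power_mono)
      qed
      show "0 \<le> D {} n / sqrt (real n)" if "n \<in> {1..(J * N)\<^sup>2} - ?g ` {..<J}" for n
        using that by (simp add: D_empty r_nonneg)
    qed simp
    finally show ?thesis .
  qed
  \<comment> \<open>The sets \<open>{}\<close> and \<open>Q\<close> both carry the sign +1, the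
    latter by \<open>prod_\<epsilon>\<close>, so their nonnegative sums cannot cancel each other and
    only bounded terms are left to balance \<open>T {}\<close>.\<close>
  have upper: "T {} K \<le> real (card (Pow Q)) * B" for K
  proof -
    have B0: "0 \<le> B" by (simp add: B_def)
    have "(\<Sum>S\<in>Pow Q. e S * T S K) = T {} K + T Q K + (\<Sum>S\<in>Pow Q - {{}, Q}. e S * T S K)"
    proof -
      have "(\<Sum>S\<in>Pow Q. e S * T S K) = (\<Sum>S\<in>{{}, Q}. e S * T S K) + (\<Sum>S\<in>Pow Q - {{}, Q}. e S * T S K)"
        using finite_Q by (intro sum.subset_diff[THEN trans[OF _ add.commute]]) auto
      then show ?thesis using \<open>Q \<noteq> {}\<close> e_Q by (simp add: e_def)
    qed
    moreover have "\<bar>\<Sum>S\<in>Pow Q - {{}, Q}. e S * T S K\<bar> \<le> (\<Sum>S\<in>Pow Q - {{}, Q}. B)"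
      by (rule order_trans[OF sum_abs sum_mono]) (auto simp: abs_mult e_abs T_bounded)
    moreover have "(\<Sum>S\<in>Pow Q - {{}, Q}. B) \<le> real (card (Pow Q)) * B"
      using B0 finite_Q by (auto intro!: mult_right_mono card_mono)
    ultimately show ?thesis using T_zero[of K] T_Q[of K] by linarith
  qed
  have "0 < N" using prod_Q_pos by (simp add: N_def)
  then show False
    using harmonic_progression_unbounded[of N "real (card (Pow Q)) * B"] T_empty upper
    by (meson linorder_not_less order_trans)
qed

end

lemma neg_one_power_half_cong:
  fixes p :: nat
  assumes "odd p"
  shows "[(-1) ^ ((p - 1) div 2) = int p] (mod 4)"
proof -
  have "p mod 4 = 1 \<or> p mod 4 = 3" using assms by presburger
  then consider k where "p = 4 * k + 1" | k where "p = 4 * k + 3"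
    by (metis mult_div_mod_eq)
  then show ?thesis
  proof cases
    case 1
    then have "(p - 1) div 2 = 2 * k" by simp
    then show ?thesis using 1 by (simp add: cong_iff_dvd_diff)
  next
    case 2
    then have "(p - 1) div 2 = Suc (2 * k)" by simp
    moreover have "(4::int) dvd -1 - int p" using 2 by (intro dvdI[of _ _ "- int k - 1"]) simp
    ultimately show ?thesis by (simp add: cong_iff_dvd_diff)
  qed
qed

lemma Legendre_prod:
  fixes q :: nat
  assumes "prime q" "2 < q"
  shows "Legendre (\<Prod>x\<in>A. f x) q = (\<Prod>x\<in>A. Legendre (f x) q)"
proof (induction A rule: infinite_finite_induct)
  case (insert x A)
  then show ?case by (simp add: Legendre_mult[OF assms])
qed (use assms in \<open>simp_all add: Legendre_1\<close>)

text \<open>The sign \<open>(-1) ^ ((p - 1) div 2)\<close> occurs once in the reciprocity law for 3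
  and once as the symbol of -1, and so cancels.\<close>

lemma Legendre_minus_3:
  fixes p :: nat
  assumes p: "prime p" "3 < p"
  shows "Legendre (-3) p = Legendre (int p) 3"
proof -
  have "Legendre (int p) (int 3) * Legendre (int 3) (int p) = (-1) ^ ((p - 1) div 2)"
    using Quadratic_Reciprocity[of p 3] p by simp
  moreover have "Legendre (-3) p = (-1) ^ ((p - 1) div 2) * Legendre 3 p"
    using Legendre_mult[of p "-1" 3] Legendre_minus_1[of p] p by simp
  moreover have "\<not> int p dvd 3" using p by (auto dest!: zdvd_imp_le)
  ultimately show ?thesis using Legendre_neq_0_cases[of p 3] by (auto simp: algebra_simps)
qed

text \<open>Split off one prime at a time and glue the roots by the Chinese remainder theorem;
  squarefreeness keeps the moduli coprime.\<close>

lemma ex_sqrt_mod_squarefree: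
  fixes t :: nat and N :: int
  assumes "squarefree t" "\<And>q. prime q \<Longrightarrow> q dvd t \<Longrightarrow> \<exists>y. int q dvd y\<^sup>2 + N"
  shows "\<exists>B. int t dvd B\<^sup>2 + N"
  using assms
proof (induction t rule: less_induct)
  case (less t)
  show ?case
  proof (cases "t = 1")
    case False
    then obtain q where q: "prime q" "q dvd t" using prime_factor_nat by blast
    then obtain u where u: "t = q * u" by blast
    have "\<not> q dvd u"
    proof
      assume "q dvd u"
      then have "q\<^sup>2 dvd t" by (simp add: u power2_eq_square)
      then show False using squarefreeD[OF less.prems(1)] q(1) not_prime_unit by blast
    qed
    then have cop: "coprime (int q) (int u)" using q(1) prime_imp_coprime by auto
    have "t \<noteq> 0" using less.prems(1) by (metis not_squarefree_0)
    then have "u < t" using u q(1) prime_gt_1_nat by fastforce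
    moreover have "squarefree u" using squarefree_mono[OF _ less.prems(1), of u] u by simp
    moreover have "\<exists>y. int p dvd y\<^sup>2 + N" if "prime p" "p dvd u" for p
      using that less.prems(2) u by auto
    ultimately obtain C where C: "int u dvd C\<^sup>2 + N" using less.IH by blast
    obtain y where y: "int q dvd y\<^sup>2 + N" using less.prems(2) q by blast
    obtain B where B: "[B = y] (mod int q)" "[B = C] (mod int u)"
      using binary_chinese_remainder_int[OF cop] by blast
    have "int q dvd B\<^sup>2 + N" "int u dvd B\<^sup>2 + N"
      using cong_dvd_iff[OF cong_add[OF cong_pow[OF B(1), of 2] cong_refl[of N]]] y
        cong_dvd_iff[OF cong_add[OF cong_pow[OF B(2), of 2] cong_refl[of N]]] C by auto
    then have "int t dvd B\<^sup>2 + N" unfolding u of_nat_mult using cop by (rule divides_mult)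
    then show ?thesis by blast
  qed auto
qed

context odd_primes
begin

section \<open>Reciprocity for the product of \<open>Q\<close> and square roots modulo
  \<open>P\<close>\<close>

lemma prod_neg_one_power_half:
  "[\<Prod>p\<in>Q. (-1) ^ ((p - 1) div 2) = int (\<Prod>Q)] (mod 4)"
proof -
  have "[\<Prod>p\<in>Q. (-1) ^ ((p - 1) div 2) = (\<Prod>p\<in>Q. int p)] (mod 4)"
  proof (rule cong_prod)
    fix p assume "p \<in> Q"
    then have "odd p" using prime_Q odd_Q prime_odd_nat by blast
    then show "[(-1) ^ ((p - 1) div 2) = int p] (mod 4)" by (rule neg_one_power_half_cong)
  qed
  then show ?thesis by simp
qed

text \<open>Reciprocity for the Jacobi symbol: for N = 3 modulo 4 the symbol of -N modulo q equals
  that of q modulo N. The prime 2 is separate, as N^2 + N is even.\<close>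

lemma Legendre_minus_prod_Q:
  assumes N: "\<Prod>Q mod 4 = 3" and q: "prime q" "q \<notin> Q" "quad_char Q Q q = 1"
  shows "\<exists>y. int q dvd y\<^sup>2 + int (\<Prod>Q)"
proof (cases "q = 2")
  case True
  have "int q dvd (int (\<Prod>Q))\<^sup>2 + int (\<Prod>Q)" unfolding True by (simp add: power2_eq_square)
  then show ?thesis by blast
next
  case False
  then have q2: "2 < q" using q(1) prime_ge_2_nat[of q] by simp
  define s where "s = (\<lambda>p::nat. (-1::int) ^ ((p - 1) div 2))"
  have "prod s Q = -1"
  proof (rule sign_cong_imp_eq[where p = 4])
    have "[prod s Q = int (\<Prod>Q)] (mod 4)" unfolding s_def by (rule prod_neg_one_power_half)
    also have "[int (\<Prod>Q) = -1] (mod 4)"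
    proof -
      have "int (\<Prod>Q) mod 4 = 3" using N by (metis of_nat_mod of_nat_numeral)
      then show ?thesis unfolding cong_def by (simp del: of_nat_prod)
    qed
    finally show "[prod s Q = -1] (mod 4)" .
    have "\<bar>prod s Q\<bar> = 1" unfolding abs_prod by (rule prod.neutral) (simp add: s_def power_abs)
    then show "prod s Q \<in> {-1, 0, 1}" by (auto simp: abs_if split: if_splits)
  qed auto
  have "(\<Prod>p\<in>Q. Legendre (int q) (int p)) = 1"
    using q(3) by (simp add: quad_char_def flip: of_int_prod split: if_splits)
  moreover have "Legendre (int p) (int q) * Legendre (int q) (int p) = s p ^ ((q - 1) div 2)" if "p \<in> Q" for p
    using Quadratic_Reciprocity[of p q] prime_Q[OF that] odd_Q[OF that] q(1,2) q2 that
    by (auto simp: s_def power_mult)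
  ultimately have "(\<Prod>p\<in>Q. Legendre (int p) (int q)) = (\<Prod>p\<in>Q. s p ^ ((q - 1) div 2))"
    by (metis (no_types, lifting) mult.right_neutral prod.cong prod.distrib)
  \<comment> \<open>The reciprocity signs multiply to the symbol of -1 modulo \<open>q\<close>,
    precisely because the signs \<open>s p\<close> multiply to -1; this offsets the minus sign of
    \<open>- int (\<Prod>Q)\<close>.\<close>
  also have "\<dots> = (-1) ^ ((q - 1) div 2)" using \<open>prod s Q = -1\<close> by (simp flip: prod_power_distrib)
  also have "\<dots> = Legendre (-1) q" using Legendre_minus_1[OF q(1) q2] by simp
  finally have "Legendre (- int (\<Prod>Q)) q = Legendre (-1) q * Legendre (-1) q"
    using Legendre_mult[OF q(1) q2, of "-1" "int (\<Prod>Q)"] Legendre_prod[OF q(1) q2, of int Q] by simp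
  also have "\<dots> = 1" using Legendre_neq_0_cases[of q "-1"] q2 by force
  finally show ?thesis using Legendre_eq_1D[of "- int (\<Prod>Q)" "int q"] by simp
qed

text \<open>\<open>P\<close> is the squarefree part of the \<open>n\<close> found above. Removing a
  square changes no nonzero symbol, and every prime left divides \<open>n\<close> to an odd power,
  so its character is 1 and \<open>- \<Prod>Q\<close> is a square modulo it.\<close>

lemma ex_prescribed_Legendre_dvd:
  assumes \<epsilon>: "\<And>p. p \<in> Q \<Longrightarrow> \<epsilon> p = 1 \<or> \<epsilon> p = (-1::int)" and prod_\<epsilon>: "(\<Prod>p\<in>Q. \<epsilon> p) = 1"
    and N: "\<Prod>Q mod 4 = 3"
  shows "\<exists>P B. 0 < P \<and> (\<forall>p\<in>Q. Legendre (int P) (int p) = \<epsilon> p) \<and> int P dvd B\<^sup>2 + int (\<Prod>Q)"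
proof -
  have "Q \<noteq> {}" using N by auto
  then obtain n where n: "0 < n" "coprime n (\<Prod>Q)" "\<And>p. p \<in> Q \<Longrightarrow> Legendre (int n) (int p) = \<epsilon> p"
    "char_divisor_sum (quad_char Q Q) n \<noteq> 0"
    using ex_prescribed_Legendre[OF \<epsilon> prod_\<epsilon>] by blast
  interpret real_char "quad_char Q Q" by (rule real_char_quad_char) simp
  define t where "t = squarefree_part n"
  have nt: "n = t * (square_part n)\<^sup>2" unfolding t_def by (rule squarefree_decompose)
  have "0 < t" using nt n(1) by (cases "t = 0") auto
  moreover have "Legendre (int t) (int p) = \<epsilon> p" if p: "p \<in> Q" for p
  proof -
    let ?L = "\<lambda>x. Legendre (int x) (int p)"
    have "?L n = ?L t * (?L (square_part n))\<^sup>2"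
      using Legendre_mult[OF prime_Q odd_Q, OF p p] arg_cong[OF nt, of int] by (simp add: power2_eq_square)
    moreover have "?L n \<noteq> 0" using n(3)[OF p] \<epsilon>[OF p] by auto
    moreover have "?L (square_part n) \<in> {-1, 0, 1}" by (rule Legendre_range)
    ultimately show ?thesis using n(3)[OF p] by auto
  qed
  moreover have "\<exists>B. int t dvd B\<^sup>2 + int (\<Prod>Q)"
  proof (rule ex_sqrt_mod_squarefree)
    show "squarefree t" unfolding t_def by simp
    fix q assume q: "prime q" "q dvd t"
    then have "q dvd n" using nt by (metis dvd_mult2)
    then have cop: "coprime q (\<Prod>Q)" using n(2) coprime_divisors dvd_refl by blast
    then have "q \<notin> Q" using coprime_prod_Q_iff by auto
    have "multiplicity q t = multiplicity q n mod 2"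
      unfolding t_def using q(1) n(1) by (simp add: prime_multiplicity_squarefree_part)
    moreover have "0 < multiplicity q t" using q \<open>0 < t\<close> by (simp add: prime_multiplicity_gt_zero_iff)
    ultimately have "odd (multiplicity q n)" by (auto simp: odd_iff_mod_2_eq_one)
    then have "quad_char Q Q q \<noteq> -1" using char_divisor_sum_odd_multiplicity[OF n(1) q(1)] n(4) by blast
    then have "quad_char Q Q q = 1" using quad_char_coprime[OF _ cop] by blast
    then show "\<exists>y. int q dvd y\<^sup>2 + int (\<Prod>Q)"
      using Legendre_minus_prod_Q[OF N q(1) \<open>q \<notin> Q\<close>] by blast
  qed
  ultimately show ?thesis by blast
qed

end

section \<open>Ternary quadratic forms of determinant 3\<close>

definition tern :: "int \<Rightarrow> int \<Rightarrow> int \<Rightarrow> int \<Rightarrow> int \<Rightarrow> int \<Rightarrow> int \<Rightarrow> int \<Rightarrow> int \<Rightarrow> int" where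
  "tern a b c d e f x y z = a * x\<^sup>2 + b * y\<^sup>2 + c * z\<^sup>2 + 2 * (d * y * z + e * x * z + f * x * y)"

definition tern_values :: "int \<Rightarrow> int \<Rightarrow> int \<Rightarrow> int \<Rightarrow> int \<Rightarrow> int \<Rightarrow> int set" where
  "tern_values a b c d e f = {v. \<exists>x y z. v = tern a b c d e f x y z}"

text \<open>Sylvester's criterion for the integral Gram matrix with diagonal \<open>a\<close>,
  \<open>b\<close>, \<open>c\<close> and off-diagonal entries \<open>d\<close> (yz),
  \<open>e\<close> (xz), \<open>f\<close> (xy), with third leading minor 3.\<close>

definition pos_det3 :: "int \<Rightarrow> int \<Rightarrow> int \<Rightarrow> int \<Rightarrow> int \<Rightarrow> int \<Rightarrow> bool" where
  "pos_det3 a b c d e f \<longleftrightarrow> 0 < a \<and> 0 < a * b - f\<^sup>2 \<and>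
     a * b * c + 2 * d * e * f - a * d\<^sup>2 - b * e\<^sup>2 - c * f\<^sup>2 = 3"

lemma tern_shift_xy:
  "tern a (b + 2 * k * f + k\<^sup>2 * a) c (d + k * e) e (f + k * a) x y z = tern a b c d e f (x + k * y) y z"
  by (simp add: tern_def power2_eq_square algebra_simps)

lemma tern_shift_xz:
  "tern a b (c + 2 * k * e + k\<^sup>2 * a) (d + k * f) (e + k * a) f x y z = tern a b c d e f (x + k * z) y z"
  by (simp add: tern_def power2_eq_square algebra_simps)

lemma tern_shift_yz:
  "tern a b (c + 2 * k * d + k\<^sup>2 * b) (d + k * b) (e + k * f) f x y z = tern a b c d e f x (y + k * z) z"
  by (simp add: tern_def power2_eq_square algebra_simps)

lemma tern_values_shift_xy:
  "tern_values a (b + 2 * k * f + k\<^sup>2 * a) c (d + k * e) e (f + k * a) = tern_values a b c d e f"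
  unfolding tern_values_def tern_shift_xy by (metis diff_add_cancel)

lemma tern_values_shift_xz:
  "tern_values a b (c + 2 * k * e + k\<^sup>2 * a) (d + k * f) (e + k * a) f = tern_values a b c d e f"
  unfolding tern_values_def tern_shift_xz by (metis diff_add_cancel)

lemma tern_values_shift_yz:
  "tern_values a b (c + 2 * k * d + k\<^sup>2 * b) (d + k * b) (e + k * f) f = tern_values a b c d e f"
  unfolding tern_values_def tern_shift_yz by (metis diff_add_cancel)

lemma tern_values_swap_xy: "tern_values b a c e d f = tern_values a b c d e f"
proof -
  have "tern b a c e d f x y z = tern a b c d e f y x z" for x y z
    by (simp add: tern_def algebra_simps)
  then show ?thesis unfolding tern_values_def by metis
qed

lemma tern_values_swap_yz: "tern_values a c b d f e = tern_values a b c d e f"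
proof -
  have "tern a c b d f e x y z = tern a b c d e f x z y" for x y z
    by (simp add: tern_def algebra_simps)
  then show ?thesis unfolding tern_values_def by metis
qed

lemma pos_det3_shift_xy:
  "pos_det3 a b c d e f \<Longrightarrow> pos_det3 a (b + 2 * k * f + k\<^sup>2 * a) c (d + k * e) e (f + k * a)"
  by (simp add: pos_det3_def power2_eq_square algebra_simps)

lemma pos_det3_shift_xz:
  "pos_det3 a b c d e f \<Longrightarrow> pos_det3 a b (c + 2 * k * e + k\<^sup>2 * a) (d + k * f) (e + k * a) f"
  by (simp add: pos_det3_def power2_eq_square algebra_simps)

lemma pos_det3_shift_yz:
  "pos_det3 a b c d e f \<Longrightarrow> pos_det3 a b (c + 2 * k * d + k\<^sup>2 * b) (d + k * b) (e + k * f) f"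
  by (simp add: pos_det3_def power2_eq_square algebra_simps)

text \<open>The Desnanot-Jacobi identity for the Gram matrix. It shows that exchanging
  \<open>y\<close> and \<open>z\<close> preserves positivity, and it bounds the minor during
  reduction.\<close>

lemma pos_det3_minor:
  assumes "pos_det3 a b c d e f"
  shows "(a * b - f\<^sup>2) * (a * c - e\<^sup>2) = 3 * a + (a * d - e * f)\<^sup>2" "0 < a * c - e\<^sup>2"
proof -
  have "(a * b - f\<^sup>2) * (a * c - e\<^sup>2) - (a * d - e * f)\<^sup>2 =
      a * (a * b * c + 2 * d * e * f - a * d\<^sup>2 - b * e\<^sup>2 - c * f\<^sup>2)"
    by (simp add: power2_eq_square algebra_simps)
  then show eq: "(a * b - f\<^sup>2) * (a * c - e\<^sup>2) = 3 * a + (a * d - e * f)\<^sup>2"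
    using assms by (simp add: pos_det3_def)
  have "0 < 3 * a + (a * d - e * f)\<^sup>2" using assms by (intro add_pos_nonneg) (auto simp: pos_det3_def)
  then show "0 < a * c - e\<^sup>2" using assms eq by (metis pos_det3_def zero_less_mult_pos)
qed

lemma pos_det3_swap_xy: "pos_det3 a b c d e f \<Longrightarrow> pos_det3 b a c e d f"
proof -
  assume *: "pos_det3 a b c d e f"
  then have "0 < a * b" "0 < a" unfolding pos_det3_def by (smt (verit) zero_le_power2)+
  then have "0 < b" by (simp add: zero_less_mult_iff)
  then show ?thesis using * by (simp add: pos_det3_def algebra_simps)
qed

lemma pos_det3_swap_yz: "pos_det3 a b c d e f \<Longrightarrow> pos_det3 a c b d f e"
  using pos_det3_minor(2)[of a b c d e f] by (simp add: pos_det3_def algebra_simps)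

lemma ex_shift_abs_le:
  fixes a b :: int
  assumes "0 < a"
  shows "\<exists>k. \<bar>2 * (b + k * a)\<bar> \<le> a"
proof
  let ?r = "(2 * b + a) mod (2 * a)"
  have "2 * (b + (- ((2 * b + a) div (2 * a))) * a) = ?r - a"
    using div_mult_mod_eq[of "2 * b + a" "2 * a"] by (simp add: algebra_simps)
  moreover have "0 \<le> ?r" "?r < 2 * a" using assms by auto
  ultimately show "\<bar>2 * (b + (- ((2 * b + a) div (2 * a))) * a)\<bar> \<le> a" by linarith
qed

text \<open>Hermite reduction: minimize first the leading coefficient, then the leading minor, over all forms
  with the same set of values.\<close>

lemma pos_det3_reduce:
  assumes "pos_det3 a b c d e f"
  obtains b' c' d' where "pos_det3 1 b' c' d' 0 0" "b' \<le> 2"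
    "tern_values 1 b' c' d' 0 0 = tern_values a b c d e f"
proof -
  define V where "V = tern_values a b c d e f"
  define G where "G = (\<lambda>a b c d e f. pos_det3 a b c d e f \<and> tern_values a b c d e f = V)"
  have "\<exists>n b c d e f. G (int n) b c d e f"
    using assms unfolding G_def V_def pos_det3_def by (metis zero_le_imp_eq_int less_imp_le)
  then obtain n where n: "\<exists>b c d e f. G (int n) b c d e f" "\<And>m. \<exists>b c d e f. G (int m) b c d e f \<Longrightarrow> n \<le> m"
    using exists_least_iff[of "\<lambda>n. \<exists>b c d e f. G (int n) b c d e f"] by (meson linorder_not_less)
  define A where "A = int n"
  have min_a: "A \<le> a" if "G a b c d e f" for a b c d e f
  proof -
    have "0 < a" using that by (simp add: G_def pos_det3_def)
    then have "\<exists>b c d e f. G (int (nat a)) b c d e f" using that by (metis int_nat_eq less_imp_le)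
    then have "n \<le> nat a" by (rule n(2))
    then show ?thesis using \<open>0 < a\<close> by (simp add: A_def)
  qed
  have "\<exists>k b c d e f. G A b c d e f \<and> A * b - f\<^sup>2 = int k"
    using n(1) unfolding A_def G_def pos_det3_def by (metis zero_le_imp_eq_int less_imp_le)
  then obtain k where k: "\<exists>b c d e f. G A b c d e f \<and> A * b - f\<^sup>2 = int k"
    "\<And>m. \<exists>b c d e f. G A b c d e f \<and> A * b - f\<^sup>2 = int m \<Longrightarrow> k \<le> m"
    using exists_least_iff[of "\<lambda>k. \<exists>b c d e f. G A b c d e f \<and> A * b - f\<^sup>2 = int k"]
    by (metis linorder_not_less)
  define M where "M = int k"
  have min_M: "M \<le> A * b - f\<^sup>2" if "G A b c d e f" for b c d e f
  proof -
    have "0 < A * b - f\<^sup>2" using that by (simp add: G_def pos_det3_def)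
    then obtain w where w: "A * b - f\<^sup>2 = int w" by (metis zero_le_imp_eq_int less_imp_le)
    then have "k \<le> w" using that by (intro k(2)) blast
    then show ?thesis using w by (simp add: M_def)
  qed
  obtain b c d e f where G: "G A b c d e f" and M: "A * b - f\<^sup>2 = M" using k(1) by (auto simp: M_def)
  have A0: "0 < A" and M0: "0 < M" using G M by (auto simp: G_def pos_det3_def)
  \<comment> \<open>Shift \<open>y\<close> by a multiple of \<open>z\<close> until the mixed minor
    is at most \<open>M / 2\<close> in absolute value. The minor obtained by exchanging
    \<open>y\<close> and \<open>z\<close> is at least \<open>M\<close> by minimality, so the
    identity yields \<open>M\<^sup>2 \<le> 3 * A + M\<^sup>2 / 4\<close>.\<close>
  have "M\<^sup>2 \<le> 4 * A"
  proof -
    obtain k where k: "\<bar>2 * (A * d - e * f + k * M)\<bar> \<le> M" using ex_shift_abs_le[OF M0] by blast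
    define c' d' e' where "c' = c + 2 * k * d + k\<^sup>2 * b" and "d' = d + k * b" and "e' = e + k * f"
    have G': "G A b c' d' e' f" using G unfolding G_def c'_def d'_def e'_def
      by (simp add: pos_det3_shift_yz tern_values_shift_yz)
    then have "G A c' b d' f e'" unfolding G_def by (simp add: pos_det3_swap_yz tern_values_swap_yz)
    then have "M \<le> A * c' - e'\<^sup>2" by (rule min_M)
    then have "M * M \<le> M * (A * c' - e'\<^sup>2)" using M0 by (intro mult_left_mono) auto
    also have "\<dots> = 3 * A + (A * d' - e' * f)\<^sup>2"
      using pos_det3_minor(1)[of A b c' d' e' f] G' M by (simp add: G_def)
    finally have 1: "M * M \<le> 3 * A + (A * d' - e' * f)\<^sup>2" .
    have "A * d' - e' * f = A * d - e * f + k * M"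
      unfolding M[symmetric] d'_def e'_def by (simp add: power2_eq_square algebra_simps)
    then have "\<bar>2 * (A * d' - e' * f)\<bar> \<le> \<bar>M\<bar>" using k by simp
    then have "2\<^sup>2 * (A * d' - e' * f)\<^sup>2 \<le> M\<^sup>2" by (simp only: abs_le_square_iff flip: power_mult_distrib)
    then show ?thesis using 1 unfolding power2_eq_square[of M] power2_eq_square[of 2] by linarith
  qed
  \<comment> \<open>The same argument in \<open>x\<close> and \<open>y\<close>: after the shift the
    second diagonal entry is at least \<open>A\<close> and \<open>2 * f'\<close> is at most
    \<open>A\<close> in absolute value.\<close>
  have "3 * A\<^sup>2 \<le> 4 * M"
  proof -
    obtain k where k: "\<bar>2 * (f + k * A)\<bar> \<le> A" using ex_shift_abs_le[OF A0] by blast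
    define b' d' f' where "b' = b + 2 * k * f + k\<^sup>2 * A" and "d' = d + k * e" and "f' = f + k * A"
    have G': "G A b' c d' e f'" using G unfolding G_def b'_def d'_def f'_def
      by (simp add: pos_det3_shift_xy tern_values_shift_xy)
    then have "G b' A c e d' f'" unfolding G_def by (simp add: pos_det3_swap_xy tern_values_swap_xy)
    then have "A \<le> b'" by (rule min_a)
    then have "A * A \<le> A * b'" using A0 by (intro mult_left_mono) auto
    also have "A * b' = M + f'\<^sup>2"
      unfolding M[symmetric] b'_def f'_def by (simp add: power2_eq_square algebra_simps)
    finally have 1: "A * A \<le> M + f'\<^sup>2" .
    have "\<bar>2 * f'\<bar> \<le> \<bar>A\<bar>" using k by (simp add: f'_def)
    then have "2\<^sup>2 * f'\<^sup>2 \<le> A\<^sup>2" by (simp only: abs_le_square_iff flip: power_mult_distrib)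
    then show ?thesis using 1 unfolding power2_eq_square[of A] power2_eq_square[of 2] by linarith
  qed
  \<comment> \<open>The two bounds combine to \<open>9 * A ^ 4 \<le> 64 * A\<close>, which fails
    from \<open>A = 2\<close> on.\<close>
  have "A = 1"
  proof (rule ccontr)
    assume "A \<noteq> 1"
    then have "2 \<le> A" using A0 by simp
    have "(3 * A\<^sup>2)\<^sup>2 \<le> (4 * M)\<^sup>2" using \<open>3 * A\<^sup>2 \<le> 4 * M\<close> by (intro power_mono) auto
    then have "9 * A ^ 3 * A \<le> 16 * M\<^sup>2" by (simp add: power_mult_distrib power2_eq_square power3_eq_cube)
    also have "\<dots> \<le> 64 * A" using \<open>M\<^sup>2 \<le> 4 * A\<close> by simp
    finally have "9 * A ^ 3 \<le> 64" using A0 by simp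
    moreover have "2 ^ 3 \<le> A ^ 3" using \<open>2 \<le> A\<close> by (intro power_mono) auto
    ultimately show False by simp
  qed
  have "M \<le> 2"
  proof (rule ccontr)
    assume "\<not> M \<le> 2"
    then have "3\<^sup>2 \<le> M\<^sup>2" by (intro power_mono) auto
    then show False using \<open>M\<^sup>2 \<le> 4 * A\<close> \<open>A = 1\<close> by simp
  qed
  have G1: "G 1 b c d e f" using G \<open>A = 1\<close> by simp
  have "G 1 (b + 2 * (-f) * f + (-f)\<^sup>2 * 1) c (d + (-f) * e) e (f + (-f) * 1)"
    using G1 pos_det3_shift_xy[of 1 b c d e f "-f"] tern_values_shift_xy[of 1 b "-f" f c d e] unfolding G_def by simp
  then have G2: "G 1 (b - f\<^sup>2) c (d - f * e) e 0" by (simp add: power2_eq_square algebra_simps)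
  then have "G 1 (b - f\<^sup>2) (c + 2 * (-e) * e + (-e)\<^sup>2 * 1) (d - f * e + (-e) * 0) (e + (-e) * 1) 0"
    using pos_det3_shift_xz[of 1 "b - f\<^sup>2" c "d - f * e" e 0 "-e"]
      tern_values_shift_xz[of 1 "b - f\<^sup>2" c "-e" e "d - f * e" 0] unfolding G_def by simp
  then have "G 1 (b - f\<^sup>2) (c - e\<^sup>2) (d - f * e) 0 0" by (simp add: power2_eq_square algebra_simps)
  moreover have "b - f\<^sup>2 \<le> 2" using M \<open>M \<le> 2\<close> \<open>A = 1\<close> by simp
  ultimately show ?thesis using that unfolding G_def V_def by blast
qed

text \<open>After reduction the form is x^2 plus a binary form of determinant 3 with leading
  coefficient 1 or 2. The latter gives 2 y^2 + 2 y z + 2 z^2 up to the sign of y z, and then 6 is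
  the value at (2, 1, 0).\<close>

lemma pos_det3_values:
  assumes "pos_det3 a b c d e f" "6 \<notin> tern_values a b c d e f"
  shows "tern_values a b c d e f = {v. \<exists>x y z. v = x\<^sup>2 + y\<^sup>2 + 3 * z\<^sup>2}"
proof -
  obtain b' c' d' where 1: "pos_det3 1 b' c' d' 0 0" "b' \<le> 2"
    "tern_values 1 b' c' d' 0 0 = tern_values a b c d e f"
    using pos_det3_reduce[OF assms(1)] by blast
  have b0: "0 < b'" using 1(1) by (simp add: pos_det3_def)
  obtain k where k: "\<bar>2 * (d' + k * b')\<bar> \<le> b'" using ex_shift_abs_le[OF b0] by blast
  define c2 d2 where "c2 = c' + 2 * k * d' + k\<^sup>2 * b'" and "d2 = d' + k * b'"
  have 2: "pos_det3 1 b' c2 d2 0 0" "tern_values 1 b' c2 d2 0 0 = tern_values a b c d e f"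
    using pos_det3_shift_yz[OF 1(1), of k] tern_values_shift_yz[of 1 b' c' k d' 0 0] 1(3)
    by (simp_all add: c2_def d2_def)
  have det: "b' * c2 - d2\<^sup>2 = 3" using 2(1) by (simp add: pos_det3_def)
  have d2: "\<bar>2 * d2\<bar> \<le> b'" using k by (simp add: d2_def)
  have "b' = 1"
  proof (rule ccontr)
    assume "b' \<noteq> 1"
    then have b2: "b' = 2" using b0 1(2) by simp
    then have "d2 = -1 \<or> d2 = 0 \<or> d2 = 1" using d2 by auto
    \<comment> \<open>With \<open>d2 = 0\<close> the determinant \<open>2 * c2\<close> would be
      even.\<close>
    then have "c2 = 2 \<and> (d2 = 1 \<or> d2 = -1)" using det b2 by auto presburger
    then have "6 = tern 1 b' c2 d2 0 0 2 1 0" using b2 by (simp add: tern_def)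
    then have "6 \<in> tern_values 1 b' c2 d2 0 0" unfolding tern_values_def by blast
    then show False using 2(2) assms(2) by simp
  qed
  moreover then have "d2 = 0" using d2 by simp
  moreover have "c2 = 3" using det calculation by simp
  ultimately have "tern_values a b c d e f = tern_values 1 1 3 0 0 0" using 2(2) by simp
  then show ?thesis by (simp add: tern_values_def tern_def)
qed

text \<open>Start from m * form = k X^2 + P y^2 + 2 B y z + C z^2 with X = m x + u y + t z and P C -
  B^2 = l m. The leading coefficient is then k m, its value at (1, 0, 0), and the determinant is k l
  = 3. It remains to choose \<open>u\<close> and \<open>t\<close> so that all coefficients are
  integral. Numbers coprime to 3 use \<open>k = 1\<close>, multiples of 3 use
  \<open>k = 3\<close>.\<close>

lemma ex_pos_det3:
  fixes m k l P B s :: int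
  assumes "0 < m" "0 < k" "k * l = 3" "0 < P" "P dvd B\<^sup>2 + l * m" "coprime P m" "coprime k m"
    and "m dvd s\<^sup>2 + k * P"
  shows "\<exists>b c d e f. pos_det3 (k * m) b c d e f \<and>
    (\<forall>x y z. \<exists>X Y. P * m * tern (k * m) b c d e f x y z = k * P * X\<^sup>2 + Y\<^sup>2 + l * m * z\<^sup>2)"
proof -
  obtain C where C: "B\<^sup>2 + l * m = P * C" using assms(5) by blast
  obtain i where i: "[k * i = 1] (mod m)" using cong_solve_coprime_int[OF assms(7)] by blast
  \<comment> \<open>\<open>u\<close> solves \<open>k * u\<^sup>2 = - P\<close> modulo
    \<open>m\<close>, which makes \<open>b\<close> integral.\<close>
  define u where "u = i * s"
  have "[(k * i) * s = 1 * s] (mod m)" using i by (rule cong_scalar_right)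
  then have "[k * u = s] (mod m)" by (simp add: u_def algebra_simps)
  then have "[(k * u)\<^sup>2 + k * P = s\<^sup>2 + k * P] (mod m)" by (intro cong_add cong_pow cong_refl)
  then have "m dvd (k * u)\<^sup>2 + k * P" using assms(8) cong_dvd_iff by blast
  then have "m dvd k * (k * u\<^sup>2 + P)" by (simp add: power2_eq_square algebra_simps)
  then have "m dvd k * u\<^sup>2 + P" using assms(7) by (simp add: coprime_dvd_mult_right_iff coprime_commute)
  then obtain b where b: "k * u\<^sup>2 + P = m * b" by blast
  have "coprime (k * u) m"
  proof (rule coprimeI)
    fix q assume q: "q dvd k * u" "q dvd m"
    then have "q dvd k * u\<^sup>2" "q dvd m * b" by (simp_all add: power2_eq_square flip: mult.assoc)
    then have "q dvd P" using b by (metis dvd_add_right_iff)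
    then show "q dvd 1" using q(2) assms(6) coprime_common_divisor by blast
  qed
  then obtain j where j: "[k * u * j = 1] (mod m)" using cong_solve_coprime_int by blast
  \<comment> \<open>\<open>t\<close> solves \<open>k * u * t = - B\<close> modulo \<open>m\<close>,
    which makes \<open>d\<close> integral; integrality of \<open>c\<close> then follows from the
    determinant \<open>P * C - B\<^sup>2 = l * m\<close>, as \<open>P\<close> is invertible modulo
    \<open>m\<close>.\<close>
  define t where "t = - B * j"
  have "[- B * (k * u * j) = - B * 1] (mod m)" using j by (rule cong_scalar_left)
  then have "[k * u * t = - B] (mod m)" by (simp add: t_def algebra_simps)
  then have "m dvd B + k * u * t" by (simp add: cong_iff_dvd_diff add.commute)
  then obtain d where d: "B + k * u * t = m * d" by blast
  have "P * (C + k * t\<^sup>2) = (B - k * u * t) * (B + k * u * t) + l * m + k * t\<^sup>2 * (k * u\<^sup>2 + P)"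
    unfolding distrib_left C[symmetric] by (simp add: power2_eq_square algebra_simps)
  also have "\<dots> = m * ((B - k * u * t) * d + l + k * t\<^sup>2 * b)" unfolding b d by (simp add: algebra_simps)
  finally have "m dvd P * (C + k * t\<^sup>2)" by simp
  then have "m dvd C + k * t\<^sup>2" using assms(6) by (simp add: coprime_dvd_mult_right_iff coprime_commute)
  then obtain c where c: "C + k * t\<^sup>2 = m * c" by blast
  have "pos_det3 (k * m) b c d (k * t) (k * u)" unfolding pos_det3_def
  proof (intro conjI)
    show "0 < k * m" using assms by simp
    have "k * m * b - (k * u)\<^sup>2 = k * (m * b - k * u\<^sup>2)" by (simp add: power2_eq_square algebra_simps)
    also have "\<dots> = k * P" unfolding b[symmetric] by simp
    finally show "0 < k * m * b - (k * u)\<^sup>2" using assms by simp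
    let ?D = "k * m * b * c + 2 * d * (k * t) * (k * u) - k * m * d\<^sup>2 - b * (k * t)\<^sup>2 - c * (k * u)\<^sup>2"
    have "m * ?D = k * ((m * b) * (m * c) + 2 * k * t * u * (m * d) - (m * d)\<^sup>2 - k * t\<^sup>2 * (m * b) - k * u\<^sup>2 * (m * c))"
      by (simp add: power2_eq_square algebra_simps)
    also have "\<dots> = k * (P * C - B\<^sup>2)"
      unfolding b[symmetric] c[symmetric] d[symmetric] by (simp add: power2_eq_square algebra_simps)
    also have "\<dots> = k * l * m" unfolding C[symmetric] by simp
    finally have "m * ?D = m * 3" using assms(3) by simp
    then show "?D = 3" using assms(1) by simp
  qed
  moreover have "P * m * tern (k * m) b c d (k * t) (k * u) x y z =
      k * P * (m * x + u * y + t * z)\<^sup>2 + (P * y + B * z)\<^sup>2 + l * m * z\<^sup>2" for x y z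
  proof -
    have "P * m * tern (k * m) b c d (k * t) (k * u) x y z =
       P * (k * m\<^sup>2 * x\<^sup>2 + (m * b) * y\<^sup>2 + (m * c) * z\<^sup>2 +
         2 * ((m * d) * y * z + k * m * t * x * z + k * m * u * x * y))"
      by (simp add: tern_def power2_eq_square algebra_simps)
    also have "\<dots> = k * P * (m * x + u * y + t * z)\<^sup>2 + (P * y + B * z)\<^sup>2 + (P * C - B\<^sup>2) * z\<^sup>2"
      unfolding b[symmetric] c[symmetric] d[symmetric] by (simp add: power2_eq_square algebra_simps)
    finally show ?thesis unfolding C[symmetric] by simp
  qed
  ultimately show ?thesis by blast
qed

section \<open>Values of \<open>x\<^sup>2 + y\<^sup>2 + 3 * z\<^sup>2\<close> congruent to 5 modulo
  8\<close>

lemma square_mod_3: "(x::int)\<^sup>2 mod 3 = (if 3 dvd x then 0 else 1)"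
proof -
  have "x mod 3 = 0 \<or> x mod 3 = 1 \<or> x mod 3 = 2" by presburger
  then have "(x mod 3)\<^sup>2 mod 3 = (if x mod 3 = 0 then 0 else 1)" by auto
  then show ?thesis unfolding power_mod dvd_eq_mod_eq_0 .
qed

lemma sum_squares_dvd_3:
  assumes "(3::int) dvd x\<^sup>2 + y\<^sup>2"
  shows "3 dvd x \<and> 3 dvd y"
proof -
  have "(x\<^sup>2 mod 3 + y\<^sup>2 mod 3) mod 3 = 0" using assms by (simp add: mod_add_eq dvd_eq_mod_eq_0)
  then show ?thesis by (auto simp: square_mod_3 split: if_splits)
qed

lemma odd_primes_prime_factors:
  assumes "odd n"
  shows "odd_primes (prime_factors n)"
proof
  fix p assume p: "p \<in> prime_factors n"
  then have "odd p" using assms by (metis dvd_trans in_prime_factors_iff)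
  moreover have "prime p" using p by auto
  ultimately show "2 < p" using prime_ge_2_nat[of p] by (cases "p = 2") auto
qed auto

lemma prod_prime_factors_squarefree:
  fixes n :: nat
  assumes "squarefree n"
  shows "\<Prod>(prime_factors n) = n"
proof -
  have "n \<noteq> 0" using assms by (metis not_squarefree_0)
  then have "(\<Prod>p\<in>prime_factors n. p ^ multiplicity p n) = n" by (simp add: prod_prime_factors)
  moreover have "(\<Prod>p\<in>prime_factors n. p ^ multiplicity p n) = \<Prod>(prime_factors n)"
    using assms \<open>n \<noteq> 0\<close> by (intro prod.cong) (auto simp: squarefree_factorial_semiring')
  ultimately show ?thesis by simp
qed

text \<open>The character has modulus 3 m. Giving \<open>P\<close> the symbol of -1 at each prime of
  \<open>m\<close> makes \<open>- P\<close> a square modulo \<open>m\<close>, and these signs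
  multiply to 1 because m = 1 modulo 4. The sign +1 at 3 makes P = 1 modulo 3, which excludes the
  value 6.\<close>

lemma squarefree_ternary_coprime_3:
  assumes m: "squarefree m" "m mod 4 = 1" "\<not> 3 dvd m"
  shows "\<exists>x y z. int m = x\<^sup>2 + y\<^sup>2 + 3 * z\<^sup>2"
proof -
  define S where "S = prime_factors m"
  define Q where "Q = insert 3 S"
  have "odd m" using m(2) by presburger
  then interpret S: odd_primes S unfolding S_def by (rule odd_primes_prime_factors)
  interpret Q: odd_primes Q by unfold_locales (auto simp: Q_def S.finite_Q S.prime_Q S.odd_Q)
  have prod_S: "\<Prod>S = m" unfolding S_def by (rule prod_prime_factors_squarefree[OF m(1)])
  have "3 \<notin> S" using m(3) by (auto simp: S_def)
  then have prod_Q: "\<Prod>Q = 3 * m" using S.finite_Q prod_S by (simp add: Q_def)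
  define \<epsilon> where "\<epsilon> = (\<lambda>p::nat. if p = 3 then 1 else (-1::int) ^ ((p - 1) div 2))"
  have \<epsilon>: "\<epsilon> p = 1 \<or> \<epsilon> p = -1" for p by (simp add: \<epsilon>_def minus_one_power_iff)
  have "prod \<epsilon> S = (\<Prod>p\<in>S. (-1) ^ ((p - 1) div 2))" using \<open>3 \<notin> S\<close> by (intro prod.cong) (auto simp: \<epsilon>_def)
  then have "[prod \<epsilon> S = int m] (mod 4)" using S.prod_neg_one_power_half prod_S by simp
  moreover have "[int m = 1] (mod 4)" using m(2) by (simp add: cong_def, presburger)
  ultimately have "[prod \<epsilon> S = 1] (mod 4)" by (rule cong_trans)
  moreover have "\<bar>prod \<epsilon> S\<bar> = 1" unfolding abs_prod by (intro prod.neutral) (simp add: \<epsilon>_def power_abs)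
  ultimately have "prod \<epsilon> S = 1" by (intro sign_cong_imp_eq[where p = 4]) (auto simp: abs_if split: if_splits)
  then have prod_\<epsilon>: "prod \<epsilon> Q = 1" using \<open>3 \<notin> S\<close> S.finite_Q by (simp add: Q_def \<epsilon>_def)
  have "\<Prod>Q mod 4 = 3" unfolding prod_Q using m(2) by presburger
  then obtain P B where P: "0 < P" and leg: "\<And>p. p \<in> Q \<Longrightarrow> Legendre (int P) (int p) = \<epsilon> p"
    and B: "int P dvd B\<^sup>2 + int (\<Prod>Q)"
    using Q.ex_prescribed_Legendre_dvd[OF \<epsilon> prod_\<epsilon>] by blast
  have "\<exists>y. int p dvd y\<^sup>2 + int P" if "prime p" "p dvd m" for p
  proof -
    have "p \<in> S" using that odd_pos[OF \<open>odd m\<close>] by (auto simp: S_def in_prime_factors_iff)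
    then have "Legendre (int P) p = Legendre (-1) p" "2 < p"
      using leg[of p] \<open>3 \<notin> S\<close> S.odd_Q[of p] Legendre_minus_1[of p] that(1) by (auto simp: Q_def \<epsilon>_def)
    moreover have "Legendre (-1) p \<noteq> 0" using \<open>2 < p\<close> by (simp add: Legendre_eq_0_iff)
    ultimately have "Legendre (- int P) p = 1"
      using Legendre_mult[of p "-1" "int P"] that(1) Legendre_range[of "-1" p] by auto
    then show ?thesis using Legendre_eq_1D[of "- int P" "int p"] by simp
  qed
  then obtain s where s: "int m dvd s\<^sup>2 + int P" using ex_sqrt_mod_squarefree[OF m(1)] by blast
  have "coprime P m"
  proof -
    have "\<not> p dvd P" if "p \<in> S" for p
      using leg[of p] that \<epsilon>[of p] Legendre_eq_0_iff[of "int P" "int p"] by (auto simp: Q_def)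
    then show ?thesis using S.coprime_prod_Q_iff[of P] by (simp add: prod_S)
  qed
  moreover have "0 < m" using m(2) by (cases m) auto
  ultimately obtain b c d e f where form: "pos_det3 (int m) b c d e f"
    "\<And>x y z. \<exists>X Y. int P * int m * tern (int m) b c d e f x y z = int P * X\<^sup>2 + Y\<^sup>2 + 3 * int m * z\<^sup>2"
    using ex_pos_det3[of "int m" 1 3 "int P" B s] P B s by (auto simp: prod_Q)
  have P3: "int P mod 3 = 1"
  proof -
    have "Legendre (int P) 3 = 1" using leg[of 3] by (simp add: Q_def \<epsilon>_def)
    then obtain y where "3 dvd y\<^sup>2 - int P" "\<not> 3 dvd int P"
      using Legendre_eq_1D[of "int P" 3] Legendre_eq_0_iff[of "int P" 3] by auto
    moreover have "y\<^sup>2 mod 3 = 0 \<or> y\<^sup>2 mod 3 = 1" by (simp add: square_mod_3)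
    ultimately show ?thesis by presburger
  qed
  \<comment> \<open>Modulo 3 the identity forces \<open>X\<close> and \<open>Y\<close> to be
    divisible by 3; dividing by 3 once leaves z^2 = 2 P = 2 modulo 3, which is impossible.\<close>
  have "6 \<notin> tern_values (int m) b c d e f"
  proof
    assume "6 \<in> tern_values (int m) b c d e f"
    then obtain x y z where "6 = tern (int m) b c d e f x y z" unfolding tern_values_def by blast
    then obtain X Y where XY: "int P * int m * 6 = int P * X\<^sup>2 + Y\<^sup>2 + 3 * int m * z\<^sup>2" using form(2) by metis
    obtain w where w: "int P = 3 * w + 1" using P3 by (metis mult_div_mod_eq)
    have "X\<^sup>2 + Y\<^sup>2 = 3 * (int P * int m * 2 - w * X\<^sup>2 - int m * z\<^sup>2)" using XY w by (simp add: algebra_simps)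
    then have "3 dvd X \<and> 3 dvd Y" by (intro sum_squares_dvd_3) simp
    then obtain X' Y' where "X = 3 * X'" "Y = 3 * Y'" by blast
    then have "int m * (2 * int P - z\<^sup>2) = 3 * (int P * X'\<^sup>2 + Y'\<^sup>2)"
      using XY by (simp add: power2_eq_square algebra_simps)
    then have "3 dvd int m * (2 * int P - z\<^sup>2)" by simp
    moreover have "\<not> 3 dvd int m" using m(3) by presburger
    then have "coprime 3 (int m)" by (intro prime_imp_coprime) simp_all
    ultimately have "3 dvd 2 * int P - z\<^sup>2" by (simp add: coprime_dvd_mult_right_iff)
    moreover have "z\<^sup>2 mod 3 = 0 \<or> z\<^sup>2 mod 3 = 1" by (simp add: square_mod_3)
    ultimately show False using P3 by presburger
  qed
  then have "tern_values (int m) b c d e f = {v. \<exists>x y z. v = x\<^sup>2 + y\<^sup>2 + 3 * z\<^sup>2}"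
    by (rule pos_det3_values[OF form(1)])
  moreover have "tern (int m) b c d e f 1 0 0 \<in> tern_values (int m) b c d e f"
    unfolding tern_values_def by blast
  ultimately show ?thesis by (simp add: tern_def)
qed

text \<open>Here the modulus is \<open>m\<close> and \<open>P\<close> receives the symbol of
  \<open>p\<close> modulo 3, which is that of -3 modulo \<open>p\<close>, so that
  \<open>- 3 * P\<close> is a square modulo \<open>m\<close>. The signs multiply to the symbol of
  \<open>m\<close> modulo 3, which is 1.\<close>

lemma squarefree_ternary_3_dvd:
  assumes m: "squarefree m" "m mod 4 = 3" "m mod 3 = 1"
  shows "\<exists>x y z. 3 * int m = x\<^sup>2 + y\<^sup>2 + 3 * z\<^sup>2"
proof -
  define Q where "Q = prime_factors m"
  have "odd m" using m(2) by presburger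
  then interpret Q: odd_primes Q unfolding Q_def by (rule odd_primes_prime_factors)
  have prod_Q: "\<Prod>Q = m" unfolding Q_def by (rule prod_prime_factors_squarefree[OF m(1)])
  have "\<not> 3 dvd m" using m(3) by presburger
  then have Q3: "3 < p" "\<not> 3 dvd p" if "p \<in> Q" for p
  proof -
    have "p \<noteq> 3" using that \<open>\<not> 3 dvd m\<close> by (auto simp: Q_def)
    then show "3 < p" using Q.odd_Q[OF that] by simp
    show "\<not> 3 dvd p" using Q.prime_Q[OF that] \<open>p \<noteq> 3\<close> primes_dvd_imp_eq[of 3 p] by auto
  qed
  define \<epsilon> where "\<epsilon> = (\<lambda>p::nat. Legendre (int p) 3)"
  have \<epsilon>: "\<epsilon> p = 1 \<or> \<epsilon> p = -1" if "p \<in> Q" for p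
    unfolding \<epsilon>_def using Q3(2)[OF that] by (intro Legendre_neq_0_cases) presburger
  have "prod \<epsilon> Q = Legendre (\<Prod>p\<in>Q. int p) 3"
    unfolding \<epsilon>_def using Legendre_prod[of 3 int Q] by simp
  also have "\<dots> = Legendre (int m) 3" using prod_Q by (simp flip: of_nat_prod)
  also have "\<dots> = Legendre 1 3" using m(3) by (intro Legendre_cong) (simp add: cong_def, presburger)
  finally have prod_\<epsilon>: "prod \<epsilon> Q = 1" by (simp add: Legendre_1)
  obtain P B where P: "0 < P" and leg: "\<And>p. p \<in> Q \<Longrightarrow> Legendre (int P) (int p) = \<epsilon> p"
    and B: "int P dvd B\<^sup>2 + int (\<Prod>Q)"
    using Q.ex_prescribed_Legendre_dvd[OF \<epsilon> prod_\<epsilon>] m(2) prod_Q by auto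
  have "\<exists>y. int p dvd y\<^sup>2 + 3 * int P" if "prime p" "p dvd m" for p
  proof -
    have p: "p \<in> Q" using that odd_pos[OF \<open>odd m\<close>] by (auto simp: Q_def in_prime_factors_iff)
    then have "Legendre (-3 * int P) p = \<epsilon> p * \<epsilon> p"
      using Legendre_mult[of p "-3" "int P"] Legendre_minus_3[OF that(1)] Q3(1)[OF p] leg[OF p] that(1)
      by (simp add: \<epsilon>_def)
    then have "Legendre (- (3 * int P)) p = 1" using \<epsilon>[OF p] by auto
    then show ?thesis using Legendre_eq_1D[of "- (3 * int P)" "int p"] by simp
  qed
  then obtain s where s: "int m dvd s\<^sup>2 + 3 * int P" using ex_sqrt_mod_squarefree[OF m(1)] by blast
  have "coprime P m"
  proof -
    have "\<not> p dvd P" if "p \<in> Q" for p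
      using leg[OF that] \<epsilon>[OF that] Legendre_eq_0_iff[of "int P" "int p"] by auto
    then show ?thesis using Q.coprime_prod_Q_iff[of P] by (simp add: prod_Q)
  qed
  moreover have "0 < m" using m(2) by (cases m) auto
  moreover have "\<not> 3 dvd int m" using \<open>\<not> 3 dvd m\<close> by presburger
  then have "coprime 3 (int m)" by (intro prime_imp_coprime) simp_all
  ultimately obtain b c d e f where form: "pos_det3 (3 * int m) b c d e f"
    "\<And>x y z. \<exists>X Y. int P * int m * tern (3 * int m) b c d e f x y z = 3 * int P * X\<^sup>2 + Y\<^sup>2 + int m * z\<^sup>2"
    using ex_pos_det3[of "int m" 3 1 "int P" B s] P B s by (auto simp: prod_Q)
  \<comment> \<open>\<open>P\<close> divides \<open>B\<^sup>2 + m\<close>, which is 1 or 2 modulo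
    3.\<close>
  have P3: "\<not> 3 dvd int P"
  proof
    assume "3 dvd int P"
    then have "3 dvd B\<^sup>2 + int m" using B dvd_trans prod_Q by blast
    moreover have "B\<^sup>2 mod 3 = 0 \<or> B\<^sup>2 mod 3 = 1" by (simp add: square_mod_3)
    ultimately show False using m(3) by presburger
  qed
  have "6 \<notin> tern_values (3 * int m) b c d e f"
  proof
    assume "6 \<in> tern_values (3 * int m) b c d e f"
    then obtain x y z where "6 = tern (3 * int m) b c d e f x y z" unfolding tern_values_def by blast
    then obtain X Y where XY: "int P * int m * 6 = 3 * int P * X\<^sup>2 + Y\<^sup>2 + int m * z\<^sup>2" using form(2) by metis
    have "int m mod 3 = 1" using m(3) by presburger
    then obtain w where w: "int m = 3 * w + 1" by (metis mult_div_mod_eq)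
    have "Y\<^sup>2 + z\<^sup>2 = 3 * (int P * int m * 2 - int P * X\<^sup>2 - w * z\<^sup>2)" using XY w by (simp add: algebra_simps)
    then have "3 dvd Y \<and> 3 dvd z" by (intro sum_squares_dvd_3) simp
    then obtain Y' z' where "Y = 3 * Y'" "z = 3 * z'" by blast
    then have "int P * (2 * int m - X\<^sup>2) = 3 * (Y'\<^sup>2 + int m * z'\<^sup>2)"
      using XY by (simp add: power2_eq_square algebra_simps)
    then have "3 dvd int P * (2 * int m - X\<^sup>2)" by simp
    moreover have "coprime 3 (int P)" using P3 by (intro prime_imp_coprime) auto
    ultimately have "3 dvd 2 * int m - X\<^sup>2" by (simp add: coprime_dvd_mult_right_iff)
    moreover have "X\<^sup>2 mod 3 = 0 \<or> X\<^sup>2 mod 3 = 1" by (simp add: square_mod_3)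
    ultimately show False using m(3) by presburger
  qed
  then have "tern_values (3 * int m) b c d e f = {v. \<exists>x y z. v = x\<^sup>2 + y\<^sup>2 + 3 * z\<^sup>2}"
    by (rule pos_det3_values[OF form(1)])
  moreover have "tern (3 * int m) b c d e f 1 0 0 \<in> tern_values (3 * int m) b c d e f"
    unfolding tern_values_def by blast
  ultimately show ?thesis by (simp add: tern_def)
qed

lemma square_mod_8: "odd (x::int) \<Longrightarrow> x\<^sup>2 mod 8 = 1"
proof -
  assume "odd x"
  then have "x mod 8 = 1 \<or> x mod 8 = 3 \<or> x mod 8 = 5 \<or> x mod 8 = 7" by presburger
  then have "(x mod 8)\<^sup>2 mod 8 = 1" by auto
  then show ?thesis unfolding power_mod .
qed

text \<open>Square factors are removed by descent: p^2 = 1 modulo 8 keeps the residue 5, and the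
  excluded shape would pass from the quotient back to \<open>m\<close>, since p^2 is either 9 or 1
  modulo 3.\<close>

lemma ex_ternary:
  fixes m :: nat
  assumes "m mod 8 = 5" "\<And>k l. m \<noteq> 9 ^ k * (9 * l + 6)"
  shows "\<exists>x y z. int m = x\<^sup>2 + y\<^sup>2 + 3 * z\<^sup>2"
  using assms
proof (induction m rule: less_induct)
  case (less m)
  have "m \<noteq> 0" using less.prems(1) by auto
  show ?case
  proof (cases "squarefree m")
    case True
    show ?thesis
    proof (cases "3 dvd m")
      case False
      have "m mod 4 = 1" using less.prems(1) by presburger
      then show ?thesis using squarefree_ternary_coprime_3[OF True _ False] by blast
    next
      case 3: True
      then obtain u where u: "m = 3 * u" by blast
      have "\<not> 3 dvd u"
      proof
        assume "3 dvd u"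
        then have "3\<^sup>2 dvd m" unfolding u by auto
        then show False using squarefreeD[OF True, of 3] by simp
      qed
      moreover have "u mod 3 \<noteq> 2"
      proof
        assume "u mod 3 = 2"
        then have "m = 9 * (u div 3) + 6" unfolding u by presburger
        then have "m = 9 ^ 0 * (9 * (u div 3) + 6)" by simp
        then show False using less.prems(2) by blast
      qed
      ultimately have "u mod 3 = 1" by presburger
      moreover have "u mod 4 = 3" using less.prems(1) unfolding u by presburger
      moreover have "squarefree u" using squarefree_mono[OF _ True, of u] u by simp
      ultimately show ?thesis using squarefree_ternary_3_dvd[of u] by (simp add: u)
    qed
  next
    case False
    then obtain p where p: "prime p" "p\<^sup>2 dvd m"
      using \<open>m \<noteq> 0\<close> by (auto simp: squarefree_factorial_semiring)
    then obtain u where u: "m = p\<^sup>2 * u" by blast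
    have "odd m" using less.prems(1) by presburger
    then have "odd p" unfolding u by simp
    then have "int (p\<^sup>2) mod 8 = 1" using square_mod_8[of "int p"] by simp
    then have p8: "p\<^sup>2 mod 8 = 1" by presburger
    have "(p\<^sup>2 mod 8) * (u mod 8) mod 8 = 5" using less.prems(1) unfolding u by (simp add: mod_mult_eq)
    then have "u mod 8 = 5" unfolding p8 by simp
    moreover have "u < m"
    proof -
      have "1 < p\<^sup>2" using prime_gt_1_nat[OF p(1)] one_less_power[of p 2] by simp
      moreover have "0 < u" using u \<open>m \<noteq> 0\<close> by (cases u) auto
      ultimately show ?thesis unfolding u by simp
    qed
    moreover have "u \<noteq> 9 ^ k * (9 * l + 6)" for k l
    proof
      assume eq: "u = 9 ^ k * (9 * l + 6)"
      show False
      proof (cases "p = 3")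
        case True
        then have "m = 9 ^ Suc k * (9 * l + 6)" unfolding u eq by simp
        then show False using less.prems(2) by blast
      next
        case False
        then have "\<not> 3 dvd p" using primes_dvd_imp_eq[of 3 p] p(1) by auto
        then have "\<not> 3 dvd int p" by presburger
        then have "int (p\<^sup>2) mod 3 = 1" using square_mod_3[of "int p"] by simp
        then have "p\<^sup>2 mod 3 = 1" by presburger
        then obtain w where w: "p\<^sup>2 = 3 * w + 1" by (metis mult_div_mod_eq)
        have "m = 9 ^ k * (9 * (l * (3 * w + 1) + 2 * w) + 6)"
          unfolding u eq w by (simp add: algebra_simps)
        then show False using less.prems(2) by blast
      qed
    qed
    ultimately obtain x y z where "int u = x\<^sup>2 + y\<^sup>2 + 3 * z\<^sup>2" using less.IH by blast
    then have "int m = (int p * x)\<^sup>2 + (int p * y)\<^sup>2 + 3 * (int p * z)\<^sup>2"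
      unfolding u by (simp add: power2_eq_square algebra_simps)
    then show ?thesis by blast
  qed
qed

section \<open>Triangular sums\<close>

lemma tri_double: "2 * tri x = x\<^sup>2 + x"
proof -
  have "even (x\<^sup>2 + x)" by simp
  then show ?thesis by (simp add: tri_def)
qed

lemma tri_odd_square: "8 * tri x + 1 = (2 * x + 1)\<^sup>2"
  using tri_double[of x] by (simp add: power2_eq_square algebra_simps)

lemma tri_nonneg: "0 \<le> tri x"
proof -
  have "0 \<le> (2 * x + 1)\<^sup>2" by simp
  then show ?thesis using tri_odd_square[of x] by linarith
qed

lemma tri_small: "tri x \<in> {0, 1, 3, 6} \<or> 10 \<le> tri x"
proof (cases "x \<in> {-4..3}")
  case True
  then have "x \<in> {-4, -3, -2, -1, 0, 1, 2, 3}" by auto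
  then show ?thesis by (auto simp: tri_def)
next
  case False
  then have "9 \<le> \<bar>2 * x + 1\<bar>" by auto
  then have "9\<^sup>2 \<le> (2 * x + 1)\<^sup>2" by (metis abs_le_square_iff abs_numeral)
  then show ?thesis using tri_odd_square[of x] by simp
qed

lemma tri_values [simp]: "tri 0 = 0" "tri 1 = 1" "tri 2 = 3" "tri 3 = 6"
  by (simp_all add: tri_def)

text \<open>The identity \<open>4 * (y\<^sup>2 + 3 * z\<^sup>2) = (y + 3 * z)\<^sup>2 + 3 * (y - z)\<^sup>2\<close> makes the even variables odd.\<close>

lemma ex_ternary_odd:
  fixes m x y z :: int
  assumes m: "m mod 8 = 5" "m = x\<^sup>2 + y\<^sup>2 + 3 * z\<^sup>2"
  shows "\<exists>x y z. odd x \<and> odd y \<and> odd z \<and> m = x\<^sup>2 + y\<^sup>2 + 3 * z\<^sup>2"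
proof -
  have even_odd: "\<exists>x y z. odd x \<and> odd y \<and> odd z \<and> m = x\<^sup>2 + y\<^sup>2 + 3 * z\<^sup>2"
    if "odd x" "even y" "even z" "m = x\<^sup>2 + y\<^sup>2 + 3 * z\<^sup>2" for x y z
  proof -
    obtain u v where uv: "y = 2 * u" "z = 2 * v" using \<open>even y\<close> \<open>even z\<close> by (elim evenE)
    \<comment> \<open>Otherwise \<open>y\<^sup>2 + 3 * z\<^sup>2\<close> would be divisible by 8,
      leaving \<open>m\<close> congruent to \<open>x\<^sup>2\<close>, hence to 1, modulo 8.\<close>
    have "odd (u + v)"
    proof
      assume "even (u + v)"
      then obtain w where "u = 2 * w - v" by (metis add_diff_cancel_right' evenE)
      then have "m = x\<^sup>2 + 8 * (2 * w\<^sup>2 - 2 * w * v + 2 * v\<^sup>2)"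
        unfolding that(4) uv by (simp only:) (simp add: power2_eq_square algebra_simps)
      then obtain q where "m = x\<^sup>2 + 8 * q" by blast
      then have "m mod 8 = x\<^sup>2 mod 8" by simp
      then show False using m(1) square_mod_8[OF that(1)] by simp
    qed
    then have "odd (u + 3 * v)" "odd (u - v)" by auto
    moreover have "m = x\<^sup>2 + (u + 3 * v)\<^sup>2 + 3 * (u - v)\<^sup>2"
      using that(4) uv by (simp add: power2_eq_square algebra_simps)
    ultimately show ?thesis using that(1) by blast
  qed
  have sq: "w\<^sup>2 mod 8 = 0 \<or> w\<^sup>2 mod 8 = 4" if "even w" for w :: int
  proof -
    obtain v where v: "w = 2 * v" using \<open>even w\<close> by blast
    have "v\<^sup>2 mod 2 = 0 \<or> v\<^sup>2 mod 2 = 1" by presburger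
    moreover have "w\<^sup>2 = 4 * v\<^sup>2" by (simp add: v power2_eq_square)
    ultimately show ?thesis by presburger
  qed
  have "odd m" using m(1) by presburger
  then have "odd x \<longleftrightarrow> (odd y \<longleftrightarrow> odd z)" unfolding m(2) by auto
  then consider "odd x" "odd y" "odd z" | "odd x" "even y" "even z" | "even x" "odd y" "even z"
    | "even x" "even y" "odd z" by blast
  then show ?thesis
  proof cases
    case 1
    then show ?thesis using m(2) by blast
  next
    case 2
    then show ?thesis using m(2) even_odd[of x y z] by blast
  next
    case 3
    moreover have "m = y\<^sup>2 + x\<^sup>2 + 3 * z\<^sup>2" using m(2) by simp
    ultimately show ?thesis using 3 even_odd[of y x z] by blast
  next
    case 4
    then obtain u v where "x = 2 * u" "y = 2 * v" by (elim evenE)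
    moreover obtain q where "z\<^sup>2 = 8 * q + 1" using square_mod_8[OF 4(3)] by (metis mult_div_mod_eq)
    ultimately have "m = 4 * (u\<^sup>2 + v\<^sup>2 + 6 * q) + 3" using m(2) by (simp add: power_mult_distrib)
    then obtain r where "m = 4 * r + 3" by blast
    then have False using m(1) by presburger
    then show ?thesis ..
  qed
qed

text \<open>Multiplying by 8 and completing squares turns a representation of \<open>n\<close> by the triangular sum with
  coefficients 1, 1, 3 into one of \<open>8 * n + 5\<close> by \<open>x\<^sup>2 + y\<^sup>2 + 3 * z\<^sup>2\<close> with odd variables; the exceptional
  numbers are those that fail at the prime 3.\<close>

definition exceptional :: "nat \<Rightarrow> bool" where
  "exceptional n \<longleftrightarrow> (\<exists>k l. 8 * n + 5 = 9 ^ k * (9 * l + 6))"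

lemma tri_113:
  assumes "\<not> exceptional n"
  shows "\<exists>x y z. int n = tri x + tri y + 3 * tri z"
proof -
  have "(8 * n + 5) mod 8 = 5" by simp
  then obtain x y z where "int (8 * n + 5) = x\<^sup>2 + y\<^sup>2 + 3 * z\<^sup>2"
    using ex_ternary[of "8 * n + 5"] assms unfolding exceptional_def by blast
  moreover have "int (8 * n + 5) mod 8 = 5" by presburger
  ultimately obtain x y z where odd: "odd x" "odd y" "odd z" and eq: "int (8 * n + 5) = x\<^sup>2 + y\<^sup>2 + 3 * z\<^sup>2"
    using ex_ternary_odd by metis
  from odd obtain u v w where uvw: "x = 2 * u + 1" "y = 2 * v + 1" "z = 2 * w + 1" by (elim oddE)
  have "int (8 * n + 5) = (8 * tri u + 1) + (8 * tri v + 1) + 3 * (8 * tri w + 1)"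
    unfolding tri_odd_square using eq uvw by simp
  then have "int n = tri u + tri v + 3 * tri w" by simp
  then show ?thesis by blast
qed

text \<open>The map u -> 9 u + 5 multiplies 8 u + 5 by 9, so it raises the exponent \<open>k\<close>
  by one; \<open>k = 0\<close> means 8 n + 5 = 6 modulo 9, that is, n = 8 modulo 9.\<close>

lemma exceptional_cases:
  assumes "exceptional n"
  shows "n mod 9 = 8 \<or> (\<exists>u. n = 9 * u + 5 \<and> exceptional u)"
proof -
  obtain k l where kl: "8 * n + 5 = 9 ^ k * (9 * l + 6)" using assms unfolding exceptional_def by (elim exE)
  show ?thesis
  proof (cases k)
    case 0
    have "8 * n + 5 = 9 * l + 6" using kl unfolding 0 by (simp only: power_0 mult_1)
    then have "n = 9 * (n - l - 1) + 8" by linarith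
    then obtain q where "n = 9 * q + 8" by blast
    then have "n mod 9 = 8" by simp
    then show ?thesis ..
  next
    case (Suc j)
    define w where "w = 9 ^ j * (9 * l + 6)"
    have "8 * n + 5 = 9 * w" using kl unfolding Suc w_def by (simp only: power_Suc mult.assoc)
    moreover have "5 \<le> n"
    proof (rule ccontr)
      assume "\<not> 5 \<le> n"
      then have "n \<in> {0, 1, 2, 3, 4}" by auto
      then show False using \<open>8 * n + 5 = 9 * w\<close> by (elim insertE emptyE) (simp_all, presburger+)
    qed
    ultimately have "n = 9 * (n - w) + 5 \<and> 8 * (n - w) + 5 = w" by linarith
    then obtain u where u: "n = 9 * u + 5" "8 * u + 5 = w" by blast
    have "exceptional u" unfolding exceptional_def using u(2) by (intro exI[of _ j] exI[of _ l]) (simp only: w_def)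
    then show ?thesis using u(1) by blast
  qed
qed

lemma exceptional_ge: "exceptional n \<Longrightarrow> 8 \<le> n"
proof (induction n rule: less_induct)
  case (less n)
  from exceptional_cases[OF less.prems] show ?case
  proof (elim disjE exE conjE)
    assume "n mod 9 = 8"
    then show ?thesis by presburger
  next
    fix u assume "n = 9 * u + 5" "exceptional u"
    then have "8 \<le> u" by (intro less.IH) simp_all
    then show ?thesis using \<open>n = 9 * u + 5\<close> by simp
  qed
qed

text \<open>The obstruction at 3. The value 77 = 89 - 12 needs one descent: 8 * 77 + 5 = 9 * 69, and
  69 is again 6 modulo 9.\<close>

lemma tri_113_mod_9:
  fixes n :: int
  assumes "n = tri x + tri y + 3 * tri z"
  shows "n mod 9 \<noteq> 8" "n \<noteq> 77"
proof -
  have no_6: "m mod 9 \<noteq> 6" if m: "m = X\<^sup>2 + Y\<^sup>2 + 3 * Z\<^sup>2" for m X Y Z :: int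
  proof
    assume "m mod 9 = 6"
    then have "3 dvd m" by presburger
    then have "3 dvd X\<^sup>2 + Y\<^sup>2" unfolding m by (simp add: dvd_add_left_iff)
    then have "3 dvd X \<and> 3 dvd Y" by (rule sum_squares_dvd_3)
    then obtain X' Y' where "X = 3 * X'" "Y = 3 * Y'" by blast
    then have "m = 3 * Z\<^sup>2 + 9 * (X'\<^sup>2 + Y'\<^sup>2)" using m by (simp add: power2_eq_square algebra_simps)
    then obtain q where "m = 3 * Z\<^sup>2 + 9 * q" by blast
    moreover have "Z\<^sup>2 mod 3 = 0 \<or> Z\<^sup>2 mod 3 = 1" by (simp add: square_mod_3)
    ultimately show False using \<open>m mod 9 = 6\<close> by presburger
  qed
  define X Y Z where "X = 2 * x + 1" and "Y = 2 * y + 1" and "Z = 2 * z + 1"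
  have eq: "8 * n + 5 = X\<^sup>2 + Y\<^sup>2 + 3 * Z\<^sup>2"
    unfolding X_def Y_def Z_def tri_odd_square[symmetric] assms by simp
  then have no: "(8 * n + 5) mod 9 \<noteq> 6" by (rule no_6)
  show "n mod 9 \<noteq> 8"
  proof
    assume "n mod 9 = 8"
    then obtain q where "n = 9 * q + 8" by (metis mult_div_mod_eq)
    then have "8 * n + 5 = 6 + 9 * (8 * q + 7)" by simp
    then have "(8 * n + 5) mod 9 = 6" by (simp only: mod_mult_self2) simp
    then show False using no by simp
  qed
  show "n \<noteq> 77"
  proof
    assume "n = 77"
    then have eq: "621 = X\<^sup>2 + Y\<^sup>2 + 3 * Z\<^sup>2" using eq by simp
    then have "X\<^sup>2 + Y\<^sup>2 = 3 * (207 - Z\<^sup>2)" by simp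
    then have "3 dvd X\<^sup>2 + Y\<^sup>2" by simp
    then have "3 dvd X \<and> 3 dvd Y" by (rule sum_squares_dvd_3)
    then obtain X' Y' where XY: "X = 3 * X'" "Y = 3 * Y'" by blast
    then have "Z\<^sup>2 = 3 * (69 - X'\<^sup>2 - Y'\<^sup>2)" using eq by (simp add: power2_eq_square)
    then have "Z\<^sup>2 mod 3 = 0" by simp
    then have "3 dvd Z" by (simp add: square_mod_3 split: if_splits)
    then obtain Z' where "Z = 3 * Z'" by blast
    then have "69 = X'\<^sup>2 + Y'\<^sup>2 + 3 * Z'\<^sup>2" using eq XY by (simp add: power2_eq_square)
    then show False using no_6[of 69 X' Y' Z'] by simp
  qed
qed

section \<open>Leaving the exceptional set with one or two further terms\<close>

lemma not_exceptional_residue: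
  assumes "r < 9" "r \<noteq> 5" "r \<noteq> 8"
  shows "\<not> exceptional (9 * q + r)"
proof
  assume "exceptional (9 * q + r)"
  then have "r = 8 \<or> (\<exists>u. 9 * q + r = 9 * u + 5)" using exceptional_cases assms(1) by fastforce
  then obtain u where "9 * q + r = 9 * u + 5" using assms(3) by blast
  then have "(9 * q + r) mod 9 = (9 * u + 5) mod 9" by (rule arg_cong)
  then show False using assms by simp
qed

lemma mod_9_eq_8E:
  fixes n :: nat
  assumes "n mod 9 = 8" "n \<noteq> 8"
  obtains q where "n = 9 * q + 17"
proof -
  obtain q where q: "n = 9 * q + 8" using assms(1) by (metis mult_div_mod_eq)
  then obtain p where "q = Suc p" using assms(2) by (cases q) auto
  then show ?thesis using that[of p] q by simp
qed

lemma not_exceptional_9_5: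
  assumes "\<not> exceptional u"
  shows "\<not> exceptional (9 * u + 5)"
proof
  assume "exceptional (9 * u + 5)"
  then consider "(9 * u + 5) mod 9 = 8" | v where "9 * u + 5 = 9 * v + 5" "exceptional v"
    using exceptional_cases by blast
  then show False using assms by cases simp_all
qed

text \<open>Exceptional numbers are 5 or 8 modulo 9. From class 8, subtracting any of these
  \<open>a\<close> once reaches another class. From class 5 this also works unless
  \<open>a = 15\<close>, which leads to class 8.\<close>

lemma ex_shift_not_exceptional:
  assumes a: "a \<in> {10, 11, 13, 14, 15, 16, 17}" and n: "n \<noteq> 8"
  shows "\<exists>t w. \<not> exceptional t \<and> int n = int t + int a * tri w"
proof (cases "exceptional n")
  case False
  then show ?thesis by (intro exI[of _ n] exI[of _ 0]) simp
next
  case True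
  consider "n mod 9 = 8" | u where "n = 9 * u + 5" "exceptional u"
    using exceptional_cases[OF True] by blast
  then show ?thesis
  proof cases
    case 1
    then obtain q where q: "n = 9 * q + 17" using n by (elim mod_9_eq_8E)
    have "\<not> exceptional (9 * q + (17 - a))" using a by (intro not_exceptional_residue) auto
    then show ?thesis using a q by (intro exI[of _ "9 * q + (17 - a)"] exI[of _ 1]) auto
  next
    case 2
    then have "8 \<le> u" by (simp add: exceptional_ge)
    then obtain v where v: "u = v + 8" by (metis add.commute le_Suc_ex)
    show ?thesis
    proof (cases "a = 15")
      case False
      \<comment> \<open>77 = 9 * 8 + 5 splits off the bound \<open>8 \<le> u\<close>, so that the
        subtraction stays within the natural numbers.\<close>
      define t where "t = 9 * v + (77 - a)"
      have t: "t = 9 * (v + (77 - a) div 9) + (77 - a) mod 9" unfolding t_def by simp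
      have "\<not> exceptional t" unfolding t using a False by (intro not_exceptional_residue) auto
      moreover have "int n = int t + int a * tri 1" using a 2 v by (auto simp: t_def)
      ultimately show ?thesis by blast
    next
      case True
      \<comment> \<open>For \<open>a = 15\<close> subtract \<open>15 * tri 2 = 45\<close>. This
        stays in class 5 but replaces \<open>u\<close> by \<open>u - 5\<close>, which is 3 or 0
        modulo 9.\<close>
      have "\<not> exceptional (v + 3)"
        using exceptional_cases[OF 2(2)]
      proof (elim disjE exE conjE)
        assume "u mod 9 = 8"
        then obtain q where "u = 9 * q + 8" by (metis mult_div_mod_eq)
        then have "v + 3 = 9 * q + 3" using v by simp
        then show ?thesis using not_exceptional_residue[of 3 q] by simp
      next
        fix w assume "u = 9 * w + 5"
        then have "v + 3 = 9 * w + 0" using v by simp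
        then show ?thesis using not_exceptional_residue[of 0 w] by simp
      qed
      then have "\<not> exceptional (9 * (v + 3) + 5)" by (rule not_exceptional_9_5)
      moreover have "int n = int (9 * (v + 3) + 5) + int a * tri 2" using 2 v True by simp
      ultimately show ?thesis by blast
    qed
  qed
qed

text \<open>Subtracting 12 leads from class 8 to class 5, where the question passes to the quotient
  by 9. For n = 9 u + 17 the identity T(3 w + 1) = 9 T(w) + 1 makes this an induction from
  \<open>u\<close> to \<open>n\<close>, and 8 n + 17 = 9 (8 u + 17) shows that only the descendants
  of 8 can fail.\<close>

lemma ex_shift_12_not_exceptional:
  assumes "\<And>k. 2 \<le> k \<Longrightarrow> 8 * n + 17 \<noteq> 9 ^ k"
  shows "\<exists>t w. \<not> exceptional t \<and> int n = int t + 12 * tri w"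
  using assms
proof (induction n rule: less_induct)
  case (less n)
  show ?case
  proof (cases "exceptional n")
    case False
    then show ?thesis by (intro exI[of _ n] exI[of _ 0]) simp
  next
    case True
    consider "n mod 9 = 8" | u where "n = 9 * u + 5" "exceptional u"
      using exceptional_cases[OF True] by blast
    then show ?thesis
    proof cases
      case 1
      have "n \<noteq> 8" using less.prems[of 2] by auto
      then obtain u where u: "n = 9 * u + 17" using 1 by (elim mod_9_eq_8E)
      have "8 * u + 17 \<noteq> 9 ^ k" if "2 \<le> k" for k
      proof
        assume "8 * u + 17 = 9 ^ k"
        moreover have "8 * n + 17 = 9 * (8 * u + 17)" unfolding u by simp
        ultimately have "8 * n + 17 = 9 ^ Suc k" by (simp only: power_Suc)
        then show False using less.prems[of "Suc k"] that by simp
      qed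
      then obtain t w where tw: "\<not> exceptional t" "int u = int t + 12 * tri w"
        using less.IH[of u] u by auto
      have "tri (3 * w + 1) = 9 * tri w + 1"
        using tri_double[of "3 * w + 1"] tri_double[of w] by (simp add: power2_eq_square algebra_simps)
      then have "int n = int (9 * t + 5) + 12 * tri (3 * w + 1)" using u tw by simp
      then show ?thesis using not_exceptional_9_5[OF tw(1)] by blast
    next
      case 2
      then have "8 \<le> u" by (simp add: exceptional_ge)
      then obtain v where "u = v + 1" by (cases u) auto
      then have "int n = int (9 * v + 2) + 12 * tri 1" using 2 by simp
      moreover have "\<not> exceptional (9 * v + 2)" by (rule not_exceptional_residue) simp_all
      ultimately show ?thesis by blast
    qed
  qed
qed

text \<open>The exponents 2 and 3 give \<open>n = 8\<close> and \<open>n = 89\<close>.\<close>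

lemma power_9_cases:
  fixes n k :: nat
  assumes "8 * n + 17 = 9 ^ k" "2 \<le> k" "n \<noteq> 8" "n \<noteq> 89"
  shows "4 \<le> k"
proof (rule ccontr)
  assume "\<not> 4 \<le> k"
  then have "k = 2 \<or> k = 3" using assms(2) by auto
  then show False using assms by auto
qed

text \<open>For n on the chain subtract \<open>b\<close> once. From 89 this reaches neither 89 nor,
  as \<open>b \<noteq> 81\<close>, the number 8. Further up, 8 n + 17 = 9^(i+1) exceeds the
  preceding power by 8 * 9^i > 8 b, so the result lies strictly between two powers.\<close>

lemma ex_shift_12_b_not_exceptional:
  assumes b: "9 \<le> b" "b \<le> 89" "b \<noteq> 81" and n: "n \<noteq> 8"
  shows "\<exists>t w v. \<not> exceptional t \<and> int n = int t + 12 * tri w + int b * tri v"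
proof (cases "\<exists>k\<ge>2. 8 * n + 17 = 9 ^ k")
  case False
  then obtain t w where "\<not> exceptional t" "int n = int t + 12 * tri w"
    using ex_shift_12_not_exceptional[of n] by blast
  then show ?thesis by (intro exI[of _ t] exI[of _ w] exI[of _ 0]) simp
next
  case True
  then obtain k where k: "2 \<le> k" "8 * n + 17 = 9 ^ k" by blast
  have "b \<le> n \<and> (\<forall>j\<ge>2. 8 * (n - b) + 17 \<noteq> 9 ^ j)"
  proof (cases "n = 89")
    case True
    have "8 * (89 - b) + 17 \<noteq> 9 ^ j" if "2 \<le> j" for j
    proof
      assume eq: "8 * (89 - b) + 17 = 9 ^ j"
      have "89 - b \<noteq> 89" using b by simp
      moreover have "89 - b \<noteq> 8" using b by arith
      ultimately have "4 \<le> j" using power_9_cases[OF eq that] by blast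
      then have "(9::nat) ^ 4 \<le> 9 ^ j" by (intro power_increasing) auto
      then show False using eq by simp
    qed
    then show ?thesis using b True by simp
  next
    case False
    then have "4 \<le> k" using power_9_cases k n by blast
    then obtain i where i: "k = Suc i" "3 \<le> i" by (cases k) auto
    have "(9::nat) ^ 3 \<le> 9 ^ i" using i by (intro power_increasing) auto
    then have big: "729 \<le> (9::nat) ^ i" by simp
    have eq: "8 * n + 17 = 9 * 9 ^ i" using k i by simp
    have "b \<le> n" using eq big b by linarith
    moreover have "8 * (n - b) + 17 \<noteq> 9 ^ j" for j
    proof
      assume "8 * (n - b) + 17 = 9 ^ j"
      then have "9 ^ i < (9::nat) ^ j" "9 ^ j < (9::nat) ^ Suc i"
        using eq big b \<open>b \<le> n\<close> unfolding power_Suc by linarith+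
      then have "i < j" "j < Suc i" by (simp_all only: power_strict_increasing_iff)
      then show False by simp
    qed
    ultimately show ?thesis by blast
  qed
  then obtain t w where "b \<le> n" "\<not> exceptional t" "int (n - b) = int t + 12 * tri w"
    using ex_shift_12_not_exceptional[of "n - b"] by blast
  then show ?thesis by (intro exI[of _ t] exI[of _ w] exI[of _ 1]) (simp add: of_nat_diff)
qed

section \<open>Sums over positions and sums over coefficient lists\<close>

lemma partial_represents_map:
  assumes "distinct js"
  shows "partial_represents \<alpha> (set js) n \<longleftrightarrow> represents (map ((!) \<alpha>) js) n"
proof -
  have bij: "bij_betw ((!) js) {..<length js} (set js)" using assms by (rule bij_betw_nth) auto
  have sum_eq: "partial_tri_sum \<alpha> (set js) x =
      partial_tri_sum (map ((!) \<alpha>) js) {..<length js} (\<lambda>i. x (js ! i))" for x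
    unfolding partial_tri_sum_def by (subst sum.reindex_bij_betw[OF bij, symmetric]) simp
  show ?thesis
  proof
    assume "partial_represents \<alpha> (set js) n"
    then show "represents (map ((!) \<alpha>) js) n"
      unfolding partial_represents_def represents_def sum_eq length_map by blast
  next
    assume "represents (map ((!) \<alpha>) js) n"
    then obtain y where y: "partial_tri_sum (map ((!) \<alpha>) js) {..<length js} y = int n"
      unfolding partial_represents_def represents_def length_map by blast
    \<comment> \<open>Transports the variables from list indices back to positions; values off
      \<open>js\<close> do not enter the partial sum.\<close>
    define x where "x = (\<lambda>k. y (inv_into {..<length js} ((!) js) k))"
    have "x (js ! i) = y i" if "i \<in> {..<length js}" for i
      unfolding x_def using bij_betw_inv_into_left[OF bij that] by simp
    then have "partial_tri_sum \<alpha> (set js) x = int n"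
      unfolding sum_eq y[symmetric] unfolding partial_tri_sum_def by (intro sum.cong) auto
    then show "partial_represents \<alpha> (set js) n" unfolding partial_represents_def by blast
  qed
qed

lemma partial_represents_mono:
  assumes "partial_represents \<alpha> J n" "J \<subseteq> I" "finite I"
  shows "partial_represents \<alpha> I n"
proof -
  obtain x where x: "partial_tri_sum \<alpha> J x = int n" using assms(1) by (auto simp: partial_represents_def)
  have "partial_tri_sum \<alpha> I (\<lambda>i. if i \<in> J then x i else 0) = partial_tri_sum \<alpha> J (\<lambda>i. if i \<in> J then x i else 0)"
    unfolding partial_tri_sum_def using assms by (intro sum.mono_neutral_right) auto
  also have "\<dots> = partial_tri_sum \<alpha> J x" unfolding partial_tri_sum_def by (intro sum.cong) auto
  finally show ?thesis using x unfolding partial_represents_def by auto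
qed

text \<open>Positions are used because coefficients repeat, and \<open>js\<close> may be in any
  order, so a selection can be listed in the order of a given pattern.\<close>

lemma represents_sublist:
  assumes "distinct js" "set js \<subseteq> {..<length \<alpha>}" "represents (map ((!) \<alpha>) js) n"
  shows "represents \<alpha> n"
  using assms partial_represents_mono[of \<alpha> "set js" n "{..<length \<alpha>}"] partial_represents_map
  by (auto simp: represents_def)

text \<open>The target \<open>v\<close> is an integer, so the rule can be iterated although the
  remainder may become negative.\<close>

lemma ex_tri_sum_Cons:
  "(\<exists>x. partial_tri_sum (a # \<alpha>) {..<length (a # \<alpha>)} x = v) \<longleftrightarrow>
    (\<exists>t x. partial_tri_sum \<alpha> {..<length \<alpha>} x = v - int a * tri t)"
proof -
  have eq: "partial_tri_sum (a # \<alpha>) {..<length (a # \<alpha>)} x =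
      int a * tri (x 0) + partial_tri_sum \<alpha> {..<length \<alpha>} (\<lambda>i. x (Suc i))" for x
    unfolding partial_tri_sum_def by (simp add: sum.lessThan_Suc_shift del: sum.lessThan_Suc)
  show ?thesis
  proof
    assume "\<exists>x. partial_tri_sum (a # \<alpha>) {..<length (a # \<alpha>)} x = v"
    then obtain x where "int a * tri (x 0) + partial_tri_sum \<alpha> {..<length \<alpha>} (\<lambda>i. x (Suc i)) = v"
      unfolding eq by blast
    then have "partial_tri_sum \<alpha> {..<length \<alpha>} (\<lambda>i. x (Suc i)) = v - int a * tri (x 0)" by simp
    then show "\<exists>t x. partial_tri_sum \<alpha> {..<length \<alpha>} x = v - int a * tri t" by blast
  next
    assume "\<exists>t x. partial_tri_sum \<alpha> {..<length \<alpha>} x = v - int a * tri t"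
    then obtain t x where "partial_tri_sum \<alpha> {..<length \<alpha>} x = v - int a * tri t" by blast
    then have "partial_tri_sum (a # \<alpha>) {..<length (a # \<alpha>)} (case_nat t x) = v" unfolding eq by simp
    then show "\<exists>x. partial_tri_sum (a # \<alpha>) {..<length (a # \<alpha>)} x = v" by blast
  qed
qed

lemma ex_tri_sum_Nil: "(\<exists>x. partial_tri_sum [] {..<length []} x = v) \<longleftrightarrow> v = 0"
  by (auto simp: partial_tri_sum_def)

lemma represents_3:
  "represents [a, b, c] n \<longleftrightarrow> (\<exists>x y z. int n = int a * tri x + int b * tri y + int c * tri z)"
  unfolding represents_def partial_represents_def ex_tri_sum_Cons ex_tri_sum_Nil
  by (simp add: algebra_simps)

lemma represents_4:
  "represents [a, b, c, d] n \<longleftrightarrow>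
    (\<exists>x y z w. int n = int a * tri x + int b * tri y + int c * tri z + int d * tri w)"
  unfolding represents_def partial_represents_def ex_tri_sum_Cons ex_tri_sum_Nil
  by (simp add: algebra_simps)

lemma represents_5:
  "represents [a, b, c, d, e] n \<longleftrightarrow>
    (\<exists>x y z w v. int n = int a * tri x + int b * tri y + int c * tri z + int d * tri w + int e * tri v)"
  unfolding represents_def partial_represents_def ex_tri_sum_Cons ex_tri_sum_Nil
  by (simp add: algebra_simps)

lemma represents_1: "represents [a] n \<longleftrightarrow> (\<exists>x. int n = int a * tri x)"
  unfolding represents_def partial_represents_def ex_tri_sum_Cons ex_tri_sum_Nil
  by (simp add: algebra_simps)

lemma represents_2: "represents [a, b] n \<longleftrightarrow> (\<exists>x y. int n = int a * tri x + int b * tri y)"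
  unfolding represents_def partial_represents_def ex_tri_sum_Cons ex_tri_sum_Nil
  by (simp add: algebra_simps)

section \<open>The candidate sums and the values they represent\<close>

definition quaternary_coeffs :: "nat set" where
  "quaternary_coeffs = {10, 11, 13, 14, 15, 16, 17}"

definition quinary_coeffs :: "nat set" where
  "quinary_coeffs = insert 12 ({18..89} - {81})"

definition minimal_sums :: "nat list set" where
  "minimal_sums = (\<lambda>a. [1, 1, 3, a]) ` quaternary_coeffs \<union>
     insert [1, 1, 3, 9, 12] ((\<lambda>b. [1, 1, 3, 12, b]) ` quinary_coeffs)"

lemma represents_113a:
  assumes "a \<in> quaternary_coeffs" "n \<noteq> 8"
  shows "represents [1, 1, 3, a] n"
proof -
  obtain t w where t: "\<not> exceptional t" "int n = int t + int a * tri w"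
    using ex_shift_not_exceptional assms unfolding quaternary_coeffs_def by blast
  obtain x y z where "int t = tri x + tri y + 3 * tri z" using tri_113[OF t(1)] by blast
  then have "int n = int 1 * tri x + int 1 * tri y + int 3 * tri z + int a * tri w" using t(2) by simp
  then show ?thesis unfolding represents_4 by blast
qed

lemma ex_113_12_b:
  assumes "9 \<le> b" "b \<le> 89" "b \<noteq> 81" "n \<noteq> 8"
  shows "\<exists>x y z w v. int n = tri x + tri y + 3 * tri z + 12 * tri w + int b * tri v"
proof -
  obtain t w v where t: "\<not> exceptional t" "int n = int t + 12 * tri w + int b * tri v"
    using ex_shift_12_b_not_exceptional[OF assms] by blast
  obtain x y z where "int t = tri x + tri y + 3 * tri z" using tri_113[OF t(1)] by blast
  then have "int n = tri x + tri y + 3 * tri z + 12 * tri w + int b * tri v" using t(2) by simp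
  then show ?thesis by blast
qed

lemma minimal_sums_represents:
  assumes "\<beta> \<in> minimal_sums" "n \<noteq> 8"
  shows "represents \<beta> n"
proof -
  consider a where "\<beta> = [1, 1, 3, a]" "a \<in> quaternary_coeffs" | "\<beta> = [1, 1, 3, 9, 12]"
    | b where "\<beta> = [1, 1, 3, 12, b]" "b \<in> quinary_coeffs"
    using assms(1) unfolding minimal_sums_def by blast
  then show ?thesis
  proof cases
    case 1
    then show ?thesis using represents_113a assms(2) by simp
  next
    case 2
    obtain x y z w v where "int n = tri x + tri y + 3 * tri z + 12 * tri w + int 9 * tri v"
      using ex_113_12_b[of 9 n] assms(2) by auto
    then have "int n = int 1 * tri x + int 1 * tri y + int 3 * tri z + int 9 * tri v + int 12 * tri w" by simp
    then show ?thesis unfolding 2 represents_5 by blast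
  next
    case 3
    then have "9 \<le> b" "b \<le> 89" "b \<noteq> 81" by (auto simp: quinary_coeffs_def)
    then obtain x y z w v where "int n = tri x + tri y + 3 * tri z + 12 * tri w + int b * tri v"
      using ex_113_12_b[of b n] assms(2) by blast
    then have "int n = int 1 * tri x + int 1 * tri y + int 3 * tri z + int 12 * tri w + int b * tri v" by simp
    then show ?thesis unfolding 3(1) represents_5 by blast
  qed
qed

text \<open>Escalation: a value missed by the positions in \<open>J\<close> needs a nonzero term
  outside \<open>J\<close>. Zeroing that term shows that the remainder is represented too, so the
  remainder cannot be 8 later on.\<close>

lemma represents_new_term:
  assumes "represents \<alpha> n" "J \<subseteq> {..<length \<alpha>}" "\<not> partial_represents \<alpha> J n"
  obtains i y where "i < length \<alpha>" "i \<notin> J" "1 \<le> tri y" "int (\<alpha> ! i) * tri y \<le> int n"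
    "\<And>m. int m = int n - int (\<alpha> ! i) * tri y \<Longrightarrow> represents \<alpha> m"
proof -
  obtain x where x: "partial_tri_sum \<alpha> {..<length \<alpha>} x = int n"
    using assms(1) by (auto simp: represents_def partial_represents_def)
  have "\<exists>i\<in>{..<length \<alpha>} - J. tri (x i) \<noteq> 0"
  proof (rule ccontr)
    assume "\<not> ?thesis"
    then have "partial_tri_sum \<alpha> {..<length \<alpha>} x = partial_tri_sum \<alpha> J x"
      unfolding partial_tri_sum_def using assms(2) by (intro sum.mono_neutral_right) auto
    then show False using assms(3) x unfolding partial_represents_def by metis
  qed
  then obtain i where i: "i < length \<alpha>" "i \<notin> J" "tri (x i) \<noteq> 0" by blast
  have split: "partial_tri_sum \<alpha> {..<length \<alpha>} u =
      int (\<alpha> ! i) * tri (u i) + partial_tri_sum \<alpha> ({..<length \<alpha>} - {i}) u" for u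
    unfolding partial_tri_sum_def using i(1) by (intro sum.remove) auto
  have "0 \<le> partial_tri_sum \<alpha> ({..<length \<alpha>} - {i}) x"
    unfolding partial_tri_sum_def by (intro sum_nonneg) (simp add: tri_nonneg)
  then have "int (\<alpha> ! i) * tri (x i) \<le> int n" using split[of x] x by simp
  moreover have "represents \<alpha> m" if "int m = int n - int (\<alpha> ! i) * tri (x i)" for m
  proof -
    have "partial_tri_sum \<alpha> ({..<length \<alpha>} - {i}) (x(i := 0)) = partial_tri_sum \<alpha> ({..<length \<alpha>} - {i}) x"
      unfolding partial_tri_sum_def by (intro sum.cong) auto
    then have "partial_tri_sum \<alpha> {..<length \<alpha>} (x(i := 0)) = int m"
      using split[of "x(i := 0)"] split[of x] x that by simp
    then show ?thesis unfolding represents_def partial_represents_def by blast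
  qed
  moreover have "1 \<le> tri (x i)" using i(3) tri_nonneg[of "x i"] by linarith
  ultimately show ?thesis using that i by blast
qed

section \<open>Values missed by truncated sums\<close>

lemma term_cases: "int a * tri x = 0 \<or> int a \<le> int a * tri x"
proof (cases "tri x = 0")
  case False
  then have "1 \<le> tri x" using tri_nonneg[of x] by linarith
  then have "int a * 1 \<le> int a * tri x" by (intro mult_left_mono) auto
  then show ?thesis by simp
qed simp

lemma big_term_eq_0: "9 \<le> a \<Longrightarrow> int a * tri x < 9 \<Longrightarrow> int a * tri x = 0"
  using term_cases[of a x] by linarith

lemma term_nonneg: "0 \<le> int a * tri x"
  by (simp add: tri_nonneg)

lemma not_represents_1_2: "\<not> represents [1] 2"
proof
  assume "represents [1] 2"
  then obtain x where "2 = tri x" unfolding represents_1 by auto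
  then show False using tri_small[of x] by simp
qed

lemma not_represents_11_5: "\<not> represents [1, 1] 5"
proof
  assume "represents [1, 1] 5"
  then obtain x y where "5 = tri x + tri y" unfolding represents_2 by auto
  then show False using tri_small[of x] tri_small[of y] tri_nonneg[of x] tri_nonneg[of y] by auto
qed

lemma not_represents_113_17: "\<not> represents [1, 1, 3] 17"
proof
  assume "represents [1, 1, 3] 17"
  then obtain x y z where "17 = tri x + tri y + 3 * tri z" unfolding represents_3 by auto
  then show False using tri_113_mod_9(1)[of 17 x y z] by simp
qed

lemma not_represents_13ab_2:
  assumes "9 \<le> a" "9 \<le> b"
  shows "\<not> represents [1, 3, a, b] 2"
proof
  assume "represents [1, 3, a, b] 2"
  then obtain x y z w where eq: "2 = tri x + 3 * tri y + int a * tri z + int b * tri w"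
    unfolding represents_4 by auto
  then have "int a * tri z < 9" "int b * tri w < 9"
    using term_nonneg[of a z] term_nonneg[of b w] tri_nonneg[of x] tri_nonneg[of y] by linarith+
  then have "2 = tri x + 3 * tri y"
    using eq big_term_eq_0[OF assms(1), of z] big_term_eq_0[OF assms(2), of w] by linarith
  then show False using tri_small[of x] tri_small[of y] tri_nonneg[of x] by auto
qed

lemma not_represents_11ab_5:
  assumes "9 \<le> a" "9 \<le> b"
  shows "\<not> represents [1, 1, a, b] 5"
proof
  assume "represents [1, 1, a, b] 5"
  then obtain x y z w where eq: "5 = tri x + tri y + int a * tri z + int b * tri w"
    unfolding represents_4 by auto
  then have "int a * tri z < 9" "int b * tri w < 9"
    using term_nonneg[of a z] term_nonneg[of b w] tri_nonneg[of x] tri_nonneg[of y] by linarith+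
  then have "5 = tri x + tri y"
    using eq big_term_eq_0[OF assms(1), of z] big_term_eq_0[OF assms(2), of w] by linarith
  then have "represents [1, 1] 5" unfolding represents_2 by auto
  then show False using not_represents_11_5 by blast
qed

lemma not_represents_113ab_8:
  assumes "9 \<le> a" "9 \<le> b"
  shows "\<not> represents [1, 1, 3, a, b] 8"
proof
  assume "represents [1, 1, 3, a, b] 8"
  then obtain x y v z w where eq: "8 = tri x + tri y + 3 * tri v + int a * tri z + int b * tri w"
    unfolding represents_5 by auto
  then have "int a * tri z < 9" "int b * tri w < 9"
    using term_nonneg[of a z] term_nonneg[of b w] tri_nonneg[of x] tri_nonneg[of y] tri_nonneg[of v] by linarith+
  then have "8 = tri x + tri y + 3 * tri v"
    using eq big_term_eq_0[OF assms(1), of z] big_term_eq_0[OF assms(2), of w] by linarith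
  then show False using tri_113_mod_9(1)[of 8 x y v] by simp
qed

text \<open>The last term is 0 or 9, and both remainders 17 and 8 are 8 modulo 9.\<close>

lemma not_represents_113a_17:
  assumes "a = 9 \<or> 18 \<le> a"
  shows "\<not> represents [1, 1, 3, a] 17"
proof
  assume "represents [1, 1, 3, a] 17"
  then obtain x y z w where eq: "17 = tri x + tri y + 3 * tri z + int a * tri w"
    unfolding represents_4 by auto
  have "int a * tri w \<le> 17" using eq tri_nonneg[of x] tri_nonneg[of y] tri_nonneg[of z] by linarith
  then have "int a * tri w = 0 \<or> int a * tri w = 9"
  proof (cases "a = 9")
    case True
    then show ?thesis using \<open>int a * tri w \<le> 17\<close> tri_small[of w] by auto
  next
    case False
    then show ?thesis using \<open>int a * tri w \<le> 17\<close> assms term_cases[of a w] by linarith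
  qed
  then have "17 = tri x + tri y + 3 * tri z \<or> 8 = tri x + tri y + 3 * tri z" using eq by auto
  then show False using tri_113_mod_9(1)[of 17 x y z] tri_113_mod_9(1)[of 8 x y z] by auto
qed

text \<open>The triangular numbers 0, 1, 3, 6 leave 89, 77, 53, 17; all but 77 are 8 modulo
  9.\<close>

lemma not_represents_113_12_89: "\<not> represents [1, 1, 3, 12] 89"
proof
  assume "represents [1, 1, 3, 12] 89"
  then obtain x y z w where eq: "89 = tri x + tri y + 3 * tri z + 12 * tri w"
    unfolding represents_4 by auto
  let ?s = "tri x + tri y + 3 * tri z"
  have "?s \<in> {89, 77, 53, 17}"
    using eq tri_small[of w] tri_nonneg[of x] tri_nonneg[of y] tri_nonneg[of z] by auto
  then show False using tri_113_mod_9[of ?s x y z] by auto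
qed

lemma represents_append_term: "represents [p, q, a] n \<Longrightarrow> represents [p, q, a, b] n"
proof -
  assume "represents [p, q, a] n"
  then obtain x y z where "int n = int p * tri x + int q * tri y + int a * tri z + int b * tri 0"
    unfolding represents_3 by auto
  then show ?thesis unfolding represents_4 by blast
qed

text \<open>Apart from 8, the numbers 1, 2, 5, 17, 89 are the least values missed by the lists [],
  [1], [1, 1], [1, 1, 3] and [1, 1, 3, 12]. Each of them forces a new coefficient of at most its
  size, and candidates that would produce 8 are discarded.\<close>

lemma contains_minimal_sum:
  assumes pos: "tri_coeffs \<alpha>" and rep: "\<And>n. n \<in> {1, 2, 5, 17, 89} \<Longrightarrow> represents \<alpha> n"
    and not8: "\<not> represents \<alpha> 8"
  obtains js where "distinct js" "set js \<subseteq> {..<length \<alpha>}" "map ((!) \<alpha>) js \<in> minimal_sums"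
proof -
  have pos: "0 < \<alpha> ! i" if "i < length \<alpha>" for i using pos that by (simp add: tri_coeffs_def)
  have sub8: "\<not> represents (map ((!) \<alpha>) js) 8" if "distinct js" "set js \<subseteq> {..<length \<alpha>}" for js
    using represents_sublist that not8 by blast
  have new: "\<exists>i y. i < length \<alpha> \<and> i \<notin> set js \<and> 1 \<le> tri y \<and> int (\<alpha> ! i) * tri y \<le> int n \<and> \<alpha> ! i \<le> n
      \<and> int (\<alpha> ! i) * tri y \<noteq> int n - 8"
    if n: "n \<in> {1, 2, 5, 17, 89}" and js: "distinct js" "set js \<subseteq> {..<length \<alpha>}"
      and "\<not> represents (map ((!) \<alpha>) js) n" for n js
  proof -
    have not_partial: "\<not> partial_represents \<alpha> (set js) n" using that partial_represents_map by blast
    then obtain i y where i: "i < length \<alpha>" "i \<notin> set js" "1 \<le> tri y" "int (\<alpha> ! i) * tri y \<le> int n"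
      "\<And>m. int m = int n - int (\<alpha> ! i) * tri y \<Longrightarrow> represents \<alpha> m"
      using represents_new_term[OF rep[OF n] js(2) not_partial] by blast
    have "int (\<alpha> ! i) * 1 \<le> int (\<alpha> ! i) * tri y" using i(3) by (intro mult_left_mono) auto
    then have "\<alpha> ! i \<le> n" using i(4) by simp
    moreover have "int (\<alpha> ! i) * tri y \<noteq> int n - 8" using i(5)[of 8] not8 by auto
    ultimately show ?thesis using i by blast
  qed
  have "\<not> represents [] 1" by (simp add: represents_def partial_represents_def partial_tri_sum_def)
  then obtain i1 where i1: "i1 < length \<alpha>" "\<alpha> ! i1 \<le> 1" using new[of 1 "[]"] by auto
  then have a1: "\<alpha> ! i1 = 1" using pos[of i1] by simp
  obtain i2 where i2: "i2 < length \<alpha>" "i2 \<noteq> i1" "\<alpha> ! i2 \<le> 2"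
    using new[of 2 "[i1]"] i1 a1 not_represents_1_2 by auto
  have "\<alpha> ! i2 \<noteq> 2"
  proof
    assume "\<alpha> ! i2 = 2"
    moreover have "int 8 = int 1 * tri 3 + int 2 * tri 1" by simp
    then have "represents [1, 2] 8" unfolding represents_2 by blast
    ultimately show False using sub8[of "[i1, i2]"] i1 i2 a1 by simp
  qed
  then have a2: "\<alpha> ! i2 = 1" using pos[of i2] i2 by simp
  obtain i3 where i3: "i3 < length \<alpha>" "i3 \<notin> {i1, i2}" "\<alpha> ! i3 \<le> 5"
    using new[of 5 "[i1, i2]"] i1 i2 a1 a2 not_represents_11_5 by auto
  have "\<not> represents [1, 1, \<alpha> ! i3] 8" using sub8[of "[i1, i2, i3]"] i1 i2 i3 a1 a2 by simp
  moreover have "represents [1, 1, c] 8" if "c \<in> {1, 2, 4, 5}" for c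
  proof -
    have "int 8 = int 1 * tri 3 + int 1 * tri 1 + int 1 * tri 1" "int 8 = int 1 * tri 3 + int 1 * tri 0 + int 2 * tri 1"
      "int 8 = int 1 * tri 2 + int 1 * tri 1 + int 4 * tri 1" "int 8 = int 1 * tri 2 + int 1 * tri 0 + int 5 * tri 1"
      by simp_all
    then show ?thesis using that unfolding represents_3 by blast
  qed
  moreover have "\<alpha> ! i3 \<in> {1, 2, 3, 4, 5}" using pos[of i3] i3 by auto
  ultimately have a3: "\<alpha> ! i3 = 3" by blast
  \<comment> \<open>Every other coefficient up to 8 would complete a representation of 8.\<close>
  have big: "9 \<le> \<alpha> ! i" if "i < length \<alpha>" "i \<notin> {i1, i2, i3}" for i
  proof (rule ccontr)
    assume "\<not> 9 \<le> \<alpha> ! i"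
    then have "\<alpha> ! i \<in> {1, 2, 3, 4, 5, 6, 7, 8}"
      using pos[OF that(1)] by (simp only: insert_iff empty_iff, presburger)
    moreover have "represents [1, 1, 3, c] 8" if "c \<in> {1, 2, 3, 4, 5, 6, 7, 8}" for c
    proof -
      have "int 8 = int 1 * tri 3 + int 1 * tri 1 + int 3 * tri 0 + int 1 * tri 1"
        "int 8 = int 1 * tri 3 + int 1 * tri 0 + int 3 * tri 0 + int 2 * tri 1"
        "int 8 = int 1 * tri 1 + int 1 * tri 1 + int 3 * tri 1 + int 3 * tri 1"
        "int 8 = int 1 * tri 2 + int 1 * tri 1 + int 3 * tri 0 + int 4 * tri 1"
        "int 8 = int 1 * tri 2 + int 1 * tri 0 + int 3 * tri 0 + int 5 * tri 1"
        "int 8 = int 1 * tri 1 + int 1 * tri 1 + int 3 * tri 0 + int 6 * tri 1"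
        "int 8 = int 1 * tri 1 + int 1 * tri 0 + int 3 * tri 0 + int 7 * tri 1"
        "int 8 = int 1 * tri 0 + int 1 * tri 0 + int 3 * tri 0 + int 8 * tri 1"
        by simp_all
      then show ?thesis using that unfolding represents_4 by blast
    qed
    ultimately have "represents [1, 1, 3, \<alpha> ! i] 8" by blast
    then show False using sub8[of "[i1, i2, i3, i]"] i1 i2 i3 a1 a2 a3 that by simp
  qed
  obtain i4 y where i4: "i4 < length \<alpha>" "i4 \<notin> {i1, i2, i3}" "1 \<le> tri y" "int (\<alpha> ! i4) * tri y \<le> 17"
    "\<alpha> ! i4 \<le> 17" "int (\<alpha> ! i4) * tri y \<noteq> 9"
    using new[of 17 "[i1, i2, i3]"] i1 i2 i3 a1 a2 a3 not_represents_113_17 by auto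
  \<comment> \<open>Within 17 the coefficient 9 occurs only once, leaving the remainder 8; 81 is
    excluded from 89 in the same way below.\<close>
  have "\<alpha> ! i4 \<noteq> 9"
  proof
    assume "\<alpha> ! i4 = 9"
    then show False using i4 tri_small[of y] by auto
  qed
  moreover have "9 \<le> \<alpha> ! i4" by (rule big[OF i4(1,2)])
  ultimately have "\<alpha> ! i4 = 12 \<or> \<alpha> ! i4 \<in> quaternary_coeffs"
    using i4(5) unfolding quaternary_coeffs_def by auto
  then show ?thesis
  proof
    assume "\<alpha> ! i4 \<in> quaternary_coeffs"
    then show ?thesis using i1 i2 i3 i4 a1 a2 a3 by (intro that[of "[i1, i2, i3, i4]"]) (auto simp: minimal_sums_def)
  next
    assume a4: "\<alpha> ! i4 = 12"
    obtain i5 v where i5: "i5 < length \<alpha>" "i5 \<notin> {i1, i2, i3, i4}" "1 \<le> tri v" "int (\<alpha> ! i5) * tri v \<le> 89"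
      "\<alpha> ! i5 \<le> 89" "int (\<alpha> ! i5) * tri v \<noteq> 81"
      using new[of 89 "[i1, i2, i3, i4]"] i1 i2 i3 i4 a1 a2 a3 a4 not_represents_113_12_89 by auto
    have "\<alpha> ! i5 \<noteq> 81"
    proof
      assume "\<alpha> ! i5 = 81"
      then show False using i5 tri_small[of v] by auto
    qed
    moreover have "9 \<le> \<alpha> ! i5" using big[OF i5(1)] i5(2) by simp
    ultimately have "\<alpha> ! i5 = 9 \<or> \<alpha> ! i5 \<in> quaternary_coeffs \<or> \<alpha> ! i5 \<in> quinary_coeffs"
      using i5(5) unfolding quaternary_coeffs_def quinary_coeffs_def
      by (simp only: insert_iff empty_iff Diff_iff atLeastAtMost_iff, presburger)
    then consider "\<alpha> ! i5 = 9" | "\<alpha> ! i5 \<in> quaternary_coeffs" | "\<alpha> ! i5 \<in> quinary_coeffs" by blast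
    then show ?thesis
    proof cases
      case 1
      then show ?thesis
        using i1 i2 i3 i4 i5 a1 a2 a3 a4 by (intro that[of "[i1, i2, i3, i5, i4]"]) (auto simp: minimal_sums_def)
    next
      case 2
      then show ?thesis
        using i1 i2 i3 i4 i5 a1 a2 a3 a4 by (intro that[of "[i1, i2, i3, i5]"]) (auto simp: minimal_sums_def)
    next
      case 3
      then show ?thesis
        using i1 i2 i3 i4 i5 a1 a2 a3 a4 by (intro that[of "[i1, i2, i3, i4, i5]"]) (auto simp: minimal_sums_def)
    qed
  qed
qed

section \<open>The criterion, properness and the classification\<close>

lemma almost_universal_except_8_iff:
  assumes "tri_coeffs \<alpha>"
  shows "almost_universal_except \<alpha> 8 \<longleftrightarrow>
    (\<forall>n\<in>{1, 2, 5, 17, 89}. represents \<alpha> n) \<and> \<not> represents \<alpha> 8"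
proof
  assume *: "(\<forall>n\<in>{1, 2, 5, 17, 89}. represents \<alpha> n) \<and> \<not> represents \<alpha> 8"
  then obtain js where "distinct js" "set js \<subseteq> {..<length \<alpha>}" "map ((!) \<alpha>) js \<in> minimal_sums"
    using contains_minimal_sum[OF assms] by blast
  then have "represents \<alpha> n" if "n \<noteq> 8" for n
    using represents_sublist minimal_sums_represents that by blast
  then show "almost_universal_except \<alpha> 8" using * unfolding almost_universal_except_def by blast
qed (simp add: almost_universal_except_def)

text \<open>By monotonicity it suffices to delete one position at a time, and since 8 is missed
  anyway, each deletion needs only one more missed value.\<close>

lemma proper_if_removals_not_represent:
  assumes "\<not> represents \<beta> 8"
    and removal: "\<And>j. j < length \<beta> \<Longrightarrow> \<exists>m. m \<noteq> 8 \<and> \<not> represents (take j \<beta> @ drop (Suc j) \<beta>) m"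
  shows "proper \<beta>"
  unfolding proper_def
proof (intro allI impI)
  fix I assume I: "I \<subset> {..<length \<beta>}"
  then obtain j where j: "j < length \<beta>" "j \<notin> I" by blast
  let ?js = "[0..<j] @ [Suc j..<length \<beta>]"
  obtain m where m: "m \<noteq> 8" "\<not> represents (take j \<beta> @ drop (Suc j) \<beta>) m" using removal[OF j(1)] by blast
  have "map ((!) \<beta>) ?js = take j \<beta> @ drop (Suc j) \<beta>"
    using j(1) by (intro nth_equalityI) (auto simp: nth_append)
  then have "\<not> partial_represents \<beta> (set ?js) m" using m(2) partial_represents_map[of ?js] by simp
  moreover have "set ?js = {..<length \<beta>} - {j}" using j(1) by auto
  then have "I \<subseteq> set ?js" using I j(2) by blast
  ultimately have "\<not> partial_represents \<beta> I m" using partial_represents_mono by blast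
  moreover have "\<not> partial_represents \<beta> I 8"
    using assms(1) partial_represents_mono[of \<beta> I 8 "{..<length \<beta>}"] I by (auto simp: represents_def)
  ultimately show "\<exists>m n. m \<noteq> n \<and> \<not> partial_represents \<beta> I m \<and> \<not> partial_represents \<beta> I n" using m(1) by blast
qed

lemma minimal_sum_cases:
  assumes "\<beta> \<in> minimal_sums"
  obtains a where "\<beta> = [1, 1, 3, a]" "10 \<le> a" "a \<le> 17"
  | a b where "\<beta> = [1, 1, 3, a, b]" "9 \<le> a" "a \<le> b"
    "\<not> represents [1, 1, 3, a] 17 \<or> \<not> represents [1, 1, 3, a] 89"
    "\<not> represents [1, 1, 3, b] 17 \<or> \<not> represents [1, 1, 3, b] 89"
proof -
  consider a where "\<beta> = [1, 1, 3, a]" "a \<in> quaternary_coeffs" | "\<beta> = [1, 1, 3, 9, 12]"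
    | b where "\<beta> = [1, 1, 3, 12, b]" "b = 12 \<or> 18 \<le> b"
    using assms unfolding minimal_sums_def quinary_coeffs_def by auto
  then show ?thesis
  proof cases
    case 1
    then show ?thesis using that(1)[of a] by (auto simp: quaternary_coeffs_def)
  next
    case 2
    then show ?thesis using that(2)[of 9 12] not_represents_113_12_89 not_represents_113a_17[of 9] by simp
  next
    case 3
    then show ?thesis using that(2)[of 12 b] not_represents_113_12_89 not_represents_113a_17[of b] by auto
  qed
qed

lemma minimal_sum_proper:
  assumes "\<beta> \<in> minimal_sums"
  shows "proper \<beta> \<and> \<not> represents \<beta> 8 \<and> tri_coeffs \<beta> \<and> sorted \<beta>"
  using assms
proof (cases rule: minimal_sum_cases)
  case (1 a)
  have not8: "\<not> represents \<beta> 8"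
  proof
    assume "represents \<beta> 8"
    \<comment> \<open>Padding with the zero term \<open>int 9 * tri 0\<close> reduces to the
      statement for five coefficients.\<close>
    then obtain x y z w where "int 8 = int 1 * tri x + int 1 * tri y + int 3 * tri z + int a * tri w + int 9 * tri 0"
      unfolding 1(1) represents_4 by auto
    then have "represents [1, 1, 3, a, 9] 8" unfolding represents_5 by blast
    then show False using not_represents_113ab_8[of a 9] 1 by simp
  qed
  moreover have "proper \<beta>"
  proof (rule proper_if_removals_not_represent[OF not8])
    fix j assume "j < length \<beta>"
    then consider "j = 0 \<or> j = 1" | "j = 2" | "j = 3" unfolding 1(1) by fastforce
    then show "\<exists>m. m \<noteq> 8 \<and> \<not> represents (take j \<beta> @ drop (Suc j) \<beta>) m"
    proof cases
      case j: 1
      have "\<not> represents [1, 3, a] 2" using not_represents_13ab_2[of a 9] represents_append_term[of 1 3 a 2 9] 1 by auto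
      then show ?thesis unfolding 1(1) using j by (intro exI[of _ 2]) auto
    next
      case j: 2
      have "\<not> represents [1, 1, a] 5" using not_represents_11ab_5[of a 9] represents_append_term[of 1 1 a 5 9] 1 by auto
      then show ?thesis unfolding 1(1) using j by (intro exI[of _ 5]) auto
    next
      case j: 3
      then show ?thesis unfolding 1(1) using not_represents_113_17 by (intro exI[of _ 17]) simp
    qed
  qed
  moreover have "tri_coeffs \<beta>" "sorted \<beta>" using 1 by (auto simp: tri_coeffs_def)
  ultimately show ?thesis by blast
next
  case (2 a b)
  then have ab: "9 \<le> a" "9 \<le> b" by auto
  have not8: "\<not> represents \<beta> 8" unfolding 2(1) by (rule not_represents_113ab_8[OF ab])
  moreover have "proper \<beta>"
  proof (rule proper_if_removals_not_represent[OF not8])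
    fix j assume "j < length \<beta>"
    then consider "j = 0 \<or> j = 1" | "j = 2" | "j = 3" | "j = 4" unfolding 2(1) by fastforce
    then show "\<exists>m. m \<noteq> 8 \<and> \<not> represents (take j \<beta> @ drop (Suc j) \<beta>) m"
    proof cases
      case j: 1
      then show ?thesis unfolding 2(1) using not_represents_13ab_2[OF ab] by (intro exI[of _ 2]) auto
    next
      case j: 2
      then show ?thesis unfolding 2(1) using not_represents_11ab_5[OF ab] by (intro exI[of _ 5]) auto
    next
      case j: 3
      have "take j \<beta> @ drop (Suc j) \<beta> = [1, 1, 3, b]" unfolding 2(1) j by simp
      moreover have "(17::nat) \<noteq> 8" "(89::nat) \<noteq> 8" by simp_all
      ultimately show ?thesis using 2(5) by metis
    next
      case j: 4
      have "take j \<beta> @ drop (Suc j) \<beta> = [1, 1, 3, a]" unfolding 2(1) j by simp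
      moreover have "(17::nat) \<noteq> 8" "(89::nat) \<noteq> 8" by simp_all
      ultimately show ?thesis using 2(4) by metis
    qed
  qed
  moreover have "tri_coeffs \<beta>" "sorted \<beta>" using 2 by (auto simp: tri_coeffs_def)
  ultimately show ?thesis by blast
qed

text \<open>A proper sum contains a minimal one, which already misses nothing but 8, so properness
  makes it use every position; two sorted lists with the same multiset are then equal.\<close>

lemma proper_almost_universal_sums_8: "proper_almost_universal_sums 8 = minimal_sums"
proof (intro equalityI subsetI)
  fix \<alpha> assume "\<alpha> \<in> proper_almost_universal_sums 8"
  then have \<alpha>: "tri_coeffs \<alpha>" "sorted \<alpha>" "almost_universal_except \<alpha> 8" "proper \<alpha>"
    by (auto simp: proper_almost_universal_sums_def)
  then obtain js where js: "distinct js" "set js \<subseteq> {..<length \<alpha>}" "map ((!) \<alpha>) js \<in> minimal_sums"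
    using contains_minimal_sum[OF \<alpha>(1)] almost_universal_except_8_iff[OF \<alpha>(1)] by metis
  have all: "partial_represents \<alpha> (set js) n" if "n \<noteq> 8" for n
    using minimal_sums_represents[OF js(3) that] partial_represents_map[OF js(1)] by blast
  have "set js = {..<length \<alpha>}"
  proof (rule ccontr)
    assume "set js \<noteq> {..<length \<alpha>}"
    then have "set js \<subset> {..<length \<alpha>}" using js(2) by blast
    then obtain m n where "m \<noteq> n" "\<not> partial_represents \<alpha> (set js) m" "\<not> partial_represents \<alpha> (set js) n"
      using \<alpha>(4) unfolding proper_def by blast
    then show False using all[of m] all[of n] by blast
  qed
  then have "set js = set [0..<length \<alpha>]" by (simp only: set_upt atLeast0LessThan)
  then have "mset js = mset [0..<length \<alpha>]"
    using set_eq_iff_mset_eq_distinct[OF js(1) distinct_upt] by blast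
  then have "mset (map ((!) \<alpha>) js) = mset (map ((!) \<alpha>) [0..<length \<alpha>])" by (simp only: mset_map)
  then have "mset (map ((!) \<alpha>) js) = mset \<alpha>" by (simp only: map_nth)
  moreover have "sorted (map ((!) \<alpha>) js)" using minimal_sum_proper[OF js(3)] by blast
  ultimately have "map ((!) \<alpha>) js = \<alpha>" using \<alpha>(2) properties_for_sort by metis
  then show "\<alpha> \<in> minimal_sums" using js(3) by simp
next
  fix \<beta> assume \<beta>: "\<beta> \<in> minimal_sums"
  then have "almost_universal_except \<beta> 8"
    using minimal_sums_represents minimal_sum_proper unfolding almost_universal_except_def by blast
  then show "\<beta> \<in> proper_almost_universal_sums 8"
    using minimal_sum_proper[OF \<beta>] by (simp add: proper_almost_universal_sums_def)
qed

section \<open>Counting\<close>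

lemma card_quaternary: "card {\<alpha> \<in> minimal_sums. length \<alpha> = 4} = 7"
proof -
  have "{\<alpha> \<in> minimal_sums. length \<alpha> = 4} = (\<lambda>a. [1, 1, 3, a]) ` quaternary_coeffs"
    by (auto simp: minimal_sums_def)
  moreover have "card ((\<lambda>a. [1, 1, 3, a]) ` quaternary_coeffs) = card quaternary_coeffs"
    by (intro card_image) (simp add: inj_on_def)
  ultimately show ?thesis by (simp add: quaternary_coeffs_def)
qed

lemma card_quinary: "card {\<alpha> \<in> minimal_sums. length \<alpha> = 5} = 73"
proof -
  have "{\<alpha> \<in> minimal_sums. length \<alpha> = 5} =
      insert [1, 1, 3, 9, 12] ((\<lambda>b. [1, 1, 3, 12, b]) ` quinary_coeffs)"
    by (auto simp: minimal_sums_def)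
  moreover have "card ((\<lambda>b. [1, 1, 3, 12, b]) ` quinary_coeffs) = card quinary_coeffs"
    by (intro card_image) (simp add: inj_on_def)
  \<comment> \<open>The 72 numbers from 18 to 89, without 81 and with 12.\<close>
  moreover have "finite quinary_coeffs" "card quinary_coeffs = 72" by (simp_all add: quinary_coeffs_def)
  ultimately show ?thesis by (simp add: card_insert_if image_iff)
qed

lemma length_minimal_sum: "\<alpha> \<in> minimal_sums \<Longrightarrow> length \<alpha> = 4 \<or> length \<alpha> = 5"
  by (auto simp: minimal_sums_def)

theorem theorem1p4:
  shows "(\<forall>\<alpha>. tri_coeffs \<alpha> \<longrightarrow>
      (almost_universal_except \<alpha> 8 \<longleftrightarrow>
        (\<forall>n\<in>{1, 2, 5, 17, 89}. represents \<alpha> n) \<and> \<not> represents \<alpha> 8)) \<and>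
    card (proper_almost_universal_sums 8) = 80 \<and>
    card {\<alpha> \<in> proper_almost_universal_sums 8. length \<alpha> = 4} = 7 \<and>
    card {\<alpha> \<in> proper_almost_universal_sums 8. length \<alpha> = 5} = 73 \<and>
    (\<forall>\<alpha> \<in> proper_almost_universal_sums 8. length \<alpha> = 4 \<or> length \<alpha> = 5)"
proof -
  have split: "minimal_sums = {\<alpha> \<in> minimal_sums. length \<alpha> = 4} \<union> {\<alpha> \<in> minimal_sums. length \<alpha> = 5}"
    using length_minimal_sum by blast
  have "card minimal_sums = 7 + 73"
    using card_quaternary card_quinary
    by (subst split, subst card_Un_disjoint) (auto intro: card_ge_0_finite)
  then show ?thesis
    using almost_universal_except_8_iff card_quaternary card_quinary length_minimal_sum
    unfolding proper_almost_universal_sums_8 by auto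
qed

end
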